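(* The space $\overline{\mathbf{H}}=\mathbf{H}\cup\partial\mathbf{H}$, endowed with its weak topology, is a metrizable strongly proximal minimal flow of the Polish group $\mathrm{Isom}(\mathbf{H})$ with exactly 2 orbits, and one of these orbits is comeager.
   Context: Let $\mathcal{H}$ be an infinite-dimensional separable real Hilbert space with Hilbert basis $(e_i)_{i\in\mathbb{N}}$ and $Q(x)=x_0^2-\sum_{i\ge1}x_i^2$, with polarized symmetric bilinear form $(\cdot,\cdot)$. The hyperbolic space is $\mathbf{H}=\{x\in\mathcal{H}: Q(x)=1,\ x_0>0\}$ with $\cosh d(x,y)=(x,y)$, identified with the set of lines of $\mathcal{H}$ on which $Q$ is positive; $\partial\mathbf{H}$ is the set of $Q$-isotropic lines and $\overline{\mathbf{H}}=\mathbf{H}\cup\partial\mathbf{H}$. $\mathrm{Isom}(\mathbf{H})=\mathrm{O}(1,\infty)/\{\pm\mathrm{Id}\}$ carries the (Polish) topology of pointwise convergence on $\mathbf{H}$ and acts on $\overline{\mathbf{H}}$ through its linear action on lines. Weak topology on $\overline{\mathbf{H}}$: with $\mathcal{H}_-=\{x\in\mathcal{H}:x_0=0\}$ and $\overline{\mathbf{D}}$ its closed unit ball, the map sending $x\in\overline{\mathbf{D}}$ to the line spanned by $e_0+x$ is a bijection $\overline{\mathbf{D}}\to\overline{\mathbf{H}}$; the weak topology on $\overline{\mathbf{H}}$ is the one corresponding to the weak topology of $\overline{\mathbf{D}}$. A $G$-flow is a continuous action $G\times X\to X$ on a non-empty compact Hausdorff space $X$; it is minimal if every orbit is dense, and strongly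 proximal if the weak-* closure of every $G$-orbit in the space $\mathrm{Prob}(X)$ of probability measures contains a Dirac mass. *)

theory Defs
  imports "HOL-Probability.Probability" "HOL-Algebra.Group_Action"
begin

section \<open>Topological groups, flows, strong proximality\<close>

definition topological_group :: "('g, 'm) monoid_scheme \<Rightarrow> 'g topology \<Rightarrow> bool" where
  "topological_group G T \<longleftrightarrow>
     group G \<and> topspace T = carrier G \<and>
     continuous_map (prod_topology T T) T (\<lambda>(g, h). g \<otimes>\<^bsub>G\<^esub> h) \<and>
     continuous_map T T (\<lambda>g. inv\<^bsub>G\<^esub> g)"

definition polish_group :: "('g, 'm) monoid_scheme \<Rightarrow> 'g topology \<Rightarrow> bool" where
  "polish_group G T \<longleftrightarrow>
     topological_group G T \<and> separable_space T \<and> completely_metrizable_space T"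

definition flow ::
    "('g, 'm) monoid_scheme \<Rightarrow> 'g topology \<Rightarrow> 'x topology \<Rightarrow> ('g \<Rightarrow> 'x \<Rightarrow> 'x) \<Rightarrow> bool" where
  "flow G T X \<phi> \<longleftrightarrow>
     topological_group G T \<and>
     topspace X \<noteq> {} \<and> compact_space X \<and> Hausdorff_space X \<and>
     group_action G (topspace X) \<phi> \<and>
     continuous_map (prod_topology T X) X (\<lambda>(g, x). \<phi> g x)"

definition minimal_flow ::
    "('g, 'm) monoid_scheme \<Rightarrow> 'g topology \<Rightarrow> 'x topology \<Rightarrow> ('g \<Rightarrow> 'x \<Rightarrow> 'x) \<Rightarrow> bool" where
  "minimal_flow G T X \<phi> \<longleftrightarrow>
     flow G T X \<phi> \<and> (\<forall>x\<in>topspace X. X closure_of (orbit G \<phi> x) = topspace X)"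

definition borel_measure_of :: "'x topology \<Rightarrow> 'x measure" where
  "borel_measure_of X = sigma (topspace X) {U. openin X U}"

text \<open>No regularity is required of the measures: on a compact metrizable space, every Borel
  probability measure is Radon.  On other compact Hausdorff spaces, regularity should be added.\<close>

definition Prob :: "'x topology \<Rightarrow> 'x measure set" where
  "Prob X = {\<mu>. prob_space \<mu> \<and> space \<mu> = topspace X \<and> sets \<mu> = sets (borel_measure_of X)}"

definition weak_star_topology :: "'x topology \<Rightarrow> 'x measure topology" where
  "weak_star_topology X =
     (let C = {f :: 'x \<Rightarrow> real. continuous_map X euclideanreal f}
      in pullback_topology (Prob X) (\<lambda>\<mu>. \<lambda>f\<in>C. integral\<^sup>L \<mu> f)
           (product_topology (\<lambda>_. euclideanreal) C))"

definition strongly_proximal_flow ::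
    "('g, 'm) monoid_scheme \<Rightarrow> 'g topology \<Rightarrow> 'x topology \<Rightarrow> ('g \<Rightarrow> 'x \<Rightarrow> 'x) \<Rightarrow> bool" where
  "strongly_proximal_flow G T X \<phi> \<longleftrightarrow>
     flow G T X \<phi> \<and>
     (\<forall>\<mu>\<in>Prob X. \<exists>x\<in>topspace X.
        return (borel_measure_of X) x
          \<in> weak_star_topology X closure_of {distr \<mu> \<mu> (\<phi> g) | g. g \<in> carrier G})"

definition nowhere_dense_in :: "'x topology \<Rightarrow> 'x set \<Rightarrow> bool" where
  "nowhere_dense_in X A \<longleftrightarrow> A \<subseteq> topspace X \<and> X interior_of (X closure_of A) = {}"

definition comeager_in :: "'x topology \<Rightarrow> 'x set \<Rightarrow> bool" where
  "comeager_in X S \<longleftrightarrow>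
     S \<subseteq> topspace X \<and>
     (\<exists>\<N>. countable \<N> \<and> (\<forall>A\<in>\<N>. nowhere_dense_in X A) \<and> topspace X - S = \<Union>\<N>)"


section \<open>The infinite-dimensional hyperbolic space\<close>

text \<open>The injectively indexed orthonormal family already forces the space to be
  infinite-dimensional, and totality forces it to be separable.\<close>

definition hilbert_basis :: "(nat \<Rightarrow> 'a::{real_inner, complete_space}) \<Rightarrow> bool" where
  "hilbert_basis e \<longleftrightarrow>
     (\<forall>i j. e i \<bullet> e j = (if i = j then 1 else 0)) \<and> closure (span (range e)) = UNIV"

context
  fixes e :: "nat \<Rightarrow> 'a::{real_inner, complete_space}"
begin

definition Q :: "'a \<Rightarrow> real" where
  "Q x = (x \<bullet> e 0)\<^sup>2 - (\<Sum>i. (x \<bullet> e (Suc i))\<^sup>2)"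

definition bil :: "'a \<Rightarrow> 'a \<Rightarrow> real" where
  "bil x y = (Q (x + y) - Q x - Q y) / 2"

definition hyp :: "'a set" where
  "hyp = {x. Q x = 1 \<and> x \<bullet> e 0 > 0}"

text \<open>The value 0 outside the hyperboloid is there because \<^locale>\<open>Metric_space\<close> requires
  nonnegativity and symmetry on the whole type.\<close>

definition hyp_dist :: "'a \<Rightarrow> 'a \<Rightarrow> real" where
  "hyp_dist x y = (if x \<in> hyp \<and> y \<in> hyp then arcosh (bil x y) else 0)"

definition lines :: "'a set set" where
  "lines = {span {v} | v. v \<noteq> 0}"

definition positive_lines :: "'a set set" where
  "positive_lines = {L \<in> lines. \<forall>x\<in>L - {0}. Q x > 0}"

definition isotropic_lines :: "'a set set" where
  "isotropic_lines = {L \<in> lines. \<forall>x\<in>L. Q x = 0}"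

definition hyp_bar :: "'a set set" where
  "hyp_bar = positive_lines \<union> isotropic_lines"

definition O1inf :: "('a \<Rightarrow> 'a) monoid" where
  "O1inf = \<lparr>carrier = {g. bounded_linear g \<and> bij g \<and> (\<forall>x. Q (g x) = Q x)},
            monoid.mult = (\<circ>), one = id\<rparr>"

definition Isom_hyp :: "('a \<Rightarrow> 'a) set monoid" where
  "Isom_hyp = O1inf Mod {id, uminus}"

text \<open>An element of \<^const>\<open>Isom_hyp\<close> is a coset \<open>c = {g, - g}\<close>, and
  \<open>g\<close>, \<open>- g\<close> map a line \<open>L\<close> to the same line, which is therefore the union below.\<close>

definition line_act :: "('a \<Rightarrow> 'a) set \<Rightarrow> 'a set \<Rightarrow> 'a set" where
  "line_act c = (\<lambda>L\<in>hyp_bar. \<Union>g\<in>c. g ` L)"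

definition hyp_act :: "('a \<Rightarrow> 'a) set \<Rightarrow> 'a \<Rightarrow> 'a" where
  "hyp_act c x = (THE y. y \<in> hyp \<and> span {y} = line_act c (span {x}))"

text \<open>The topology of pointwise convergence on the metric space \<^const>\<open>hyp\<close>.\<close>

definition Isom_topology :: "('a \<Rightarrow> 'a) set topology" where
  "Isom_topology =
     pullback_topology (carrier Isom_hyp) (\<lambda>c. \<lambda>x\<in>hyp. hyp_act c x)
       (product_topology (\<lambda>_. Metric_space.mtopology hyp hyp_dist) hyp)"

definition disc_bar :: "'a set" where
  "disc_bar = {x. x \<bullet> e 0 = 0 \<and> norm x \<le> 1}"

definition disc_line :: "'a \<Rightarrow> 'a set" where
  "disc_line x = span {e 0 + x}"

end

definition weak_topology :: "'a::real_normed_vector topology" where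
  "weak_topology =
     pullback_topology UNIV (\<lambda>x f. blinfun_apply f x)
       (product_topology (\<lambda>_ :: 'a \<Rightarrow>\<^sub>L real. euclideanreal) UNIV)"

text \<open>The weak topology of the closed unit ball of the hyperplane \<open>x\<^sub>0 = 0\<close> is induced by the weak
  topology of the whole space, since functionals on the hyperplane extend (by orthogonal
  projection).  It is transported along the bijection \<^const>\<open>disc_line\<close>.\<close>

definition weak_hyp_bar :: "(nat \<Rightarrow> 'a::{real_inner, complete_space}) \<Rightarrow> 'a set topology" where
  "weak_hyp_bar e =
     pullback_topology (hyp_bar e) (inv_into (disc_bar e) (disc_line e))
       (subtopology weak_topology (disc_bar e))"

end

theory Submission
  imports Defs
begin

text \<open>
  A reflection of \<open>Q\<close> exchanges any two vectors \<open>u\<close>, \<open>v\<close> with \<open>Q u = Q v\<close> and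
  \<open>Q (u - v) \<noteq> 0\<close>, so the group acts transitively on the hyperbolic space and on its boundary.  In
  infinite dimension the unit sphere is a weakly dense \<open>G\<^sub>\<delta>\<close> of the unit ball; hence minimality, and
  the boundary is comeager.  The reflections along vectors \<open>w\<^sub>n\<close> that tend to an isotropic \<open>v\<close> move
  every point other than the line of \<open>v\<close> to this line; if that line is not an atom of a probability
  measure, dominated convergence makes the images of the measure tend to a Dirac mass.

  Each class of isometries has a unique representative \<open>g\<close> with \<open>(g e\<^sub>0)\<^sub>0 > 0\<close>, and
  \<open>\<parallel>g\<parallel> \<le> 2 (g e\<^sub>0)\<^sub>0\<close>.  As points of the hyperboloid converge as soon as they converge weakly, the
  topology of the group is the one of matrix coefficients; the inverse of \<open>g\<close> has the same
  coefficients up to sign and transposition.  This gives separability and joint continuity, and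
  \<open>g \<mapsto> (g e\<^sub>n, g\<^sup>-\<^sup>1 e\<^sub>n)\<^sub>n\<close> is a closed embedding into a complete metric space.
\<close>

text \<open>The obstacle is that inner products are not jointly continuous for the weak topology.
  Wherever a moving isometry meets a weakly moving vector, it is carried across the inner product:
  \<open>g x \<bullet> y\<close> becomes \<open>x \<bullet> J (gi g (J y))\<close>, where the
  operator acts on a fixed vector and moves continuously in norm. The sign change \<open>J\<close>
  converts invariance of the form into this adjunction. Norms are controlled by |x|^2 = 2 x_0^2 - Q
  x: where \<open>Q\<close> is known, one coordinate decides the norm. This identity is behind the
  operator bound, the boundedness of inverses, and the passage from weak to norm convergence on the
  hyperboloid. On the ball of lines it gives nothing of the kind, because representatives are
  normalised by x_0 = 1 and \<open>Q\<close> varies. The contraction says nothing about the limit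
  line itself, so the target must depend on the measure. A finite measure has only countably many
  atoms and the boundary is uncountable, so a suitable line exists.\<close>

section \<open>Limits and continuity in normed and general topological spaces\<close>

lemma continuous_map_euclidean_tendsto:
  "continuous_map X euclidean f \<longleftrightarrow> (\<forall>x\<in>topspace X. (f \<longlongrightarrow> f x) (atin X x))"
  by (simp add: continuous_map_atin)

text \<open>All continuity and convergence statements below are reduced by this lemma to the vectors of
  a total family.\<close>

lemma tendsto_closure_span:
  fixes f :: "'c \<Rightarrow> 'a::real_normed_vector \<Rightarrow> 'b::real_normed_vector"
  assumes f: "\<forall>\<^sub>F c in F. linear (f c) \<and> (\<forall>x. norm (f c x) \<le> B * norm x)"
    and f0: "linear f0" "\<And>x. norm (f0 x) \<le> B * norm x"
    and S: "\<And>s. s \<in> S \<Longrightarrow> ((\<lambda>c. f c s) \<longlongrightarrow> f0 s) F"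
    and x: "x \<in> closure (span S)"
  shows "((\<lambda>c. f c x) \<longlongrightarrow> f0 x) F"
proof -
  have span: "((\<lambda>c. f c y) \<longlongrightarrow> f0 y) F" if "y \<in> span S" for y
    using that
  proof (induction rule: span_induct_alt)
    case base
    have "\<forall>\<^sub>F c in F. f c 0 = 0"
      using f by eventually_elim (simp add: linear_0)
    then show ?case
      using f0(1) by (simp add: linear_0 tendsto_eventually)
  next
    case (step a s y)
    have "((\<lambda>c. a *\<^sub>R f c s + f c y) \<longlongrightarrow> a *\<^sub>R f0 s + f0 y) F"
      using S step by (intro tendsto_intros) auto
    moreover have "\<forall>\<^sub>F c in F. a *\<^sub>R f c s + f c y = f c (a *\<^sub>R s + y)"
      using f by eventually_elim (simp add: linear_add linear_scale)
    ultimately show ?case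
      using f0(1) by (simp add: linear_add linear_scale Lim_transform_eventually)
  qed
  show ?thesis
    unfolding tendsto_iff
  proof (intro allI impI)
    fix \<epsilon> :: real assume "\<epsilon> > 0"
    \<comment> \<open>\<open>B\<close> may be zero or negative; \<open>C\<close> is a positive bound
      that can be divided by.\<close>
    define C where "C = max B 0 + 1"
    have C: "C > 0" "B \<le> C" by (auto simp: C_def)
    obtain y where y: "y \<in> span S" "dist y x < \<epsilon> / (4 * C)"
      using x \<open>\<epsilon> > 0\<close> C(1) unfolding closure_approachable by (metis divide_pos_pos zero_less_mult_iff zero_less_numeral)
    have small: "norm (h (x - y)) \<le> \<epsilon> / 4" if "\<And>x. norm (h x) \<le> B * norm x" for h :: "'a \<Rightarrow> 'b"
    proof -
      have "norm (h (x - y)) \<le> B * norm (x - y)" by (rule that)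
      also have "\<dots> \<le> C * norm (x - y)" using C by (intro mult_right_mono) auto
      also have "\<dots> \<le> C * (\<epsilon> / (4 * C))"
        using y(2) C by (intro mult_left_mono) (auto simp: dist_norm norm_minus_commute)
      finally show ?thesis using C by simp
    qed
    have "\<forall>\<^sub>F c in F. dist (f c y) (f0 y) < \<epsilon> / 4"
      by (rule tendstoD[OF span[OF y(1)]]) (use \<open>\<epsilon> > 0\<close> in simp)
    with f show "\<forall>\<^sub>F c in F. dist (f c x) (f0 x) < \<epsilon>"
    proof eventually_elim
      case (elim c)
      have "f c x - f0 x = f c (x - y) + (f c y - f0 y) - f0 (x - y)"
        using elim f0(1) by (simp add: linear_diff)
      then have "norm (f c x - f0 x) \<le> norm (f c (x - y)) + norm (f c y - f0 y) + norm (f0 (x - y))"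
        using norm_triangle_ineq4 norm_triangle_ineq by (smt (verit))
      then show ?case
        using small[of "f c"] small[of f0] elim f0(2) \<open>\<epsilon> > 0\<close> by (simp add: dist_norm)
    qed
  qed
qed

lemma continuous_map_inner:
  fixes f g :: "'c \<Rightarrow> 'b::real_inner"
  assumes "continuous_map X euclidean f" "continuous_map X euclidean g"
  shows "continuous_map X euclideanreal (\<lambda>t. f t \<bullet> g t)"
  using assms unfolding continuous_map_euclidean_tendsto by (auto intro: tendsto_inner)

lemma homeomorphic_space_image:
  assumes "inj_on E (topspace X)" "continuous_map X P E"
    "continuous_map (subtopology P (E ` topspace X)) X (inv_into (topspace X) E)"
  shows "X homeomorphic_space subtopology P (E ` topspace X)"
  unfolding homeomorphic_space_def
proof (intro exI)
  show "homeomorphic_maps X (subtopology P (E ` topspace X)) E (inv_into (topspace X) E)"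
    using assms unfolding homeomorphic_maps_def
    by (auto simp: continuous_map_in_subtopology inv_into_f_f f_inv_into_f)
qed

lemma second_countable_euclidean:
  "second_countable (euclidean :: 'b::second_countable_topology topology)"
proof -
  obtain B :: "'b set set" where B: "countable B" "\<And>C. C \<in> B \<Longrightarrow> open C"
    "\<And>S. open S \<Longrightarrow> \<exists>U. U \<subseteq> B \<and> S = \<Union>U"
    using univ_second_countable by metis
  show ?thesis
    unfolding second_countable_def
  proof (intro exI[of _ B] conjI allI impI ballI)
    fix U and x :: 'b assume "openin euclidean U \<and> x \<in> U"
    then show "\<exists>V\<in>B. x \<in> V \<and> V \<subseteq> U"
      using B(3)[of U] by (metis Union_iff Union_upper open_openin subsetD)
  qed (use B in auto)
qed

lemma limitin_pullback_topology:
  assumes "l \<in> A" "\<forall>\<^sub>F t in F. g t \<in> A" "limitin T (\<lambda>t. f (g t)) (f l) F"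
  shows "limitin (pullback_topology A f T) g l F"
  unfolding limitin_def
proof (intro conjI allI impI)
  show "l \<in> topspace (pullback_topology A f T)"
    using assms limitin_topspace[OF assms(3)] by (simp add: topspace_pullback_topology)
  fix U assume "openin (pullback_topology A f T) U \<and> l \<in> U"
  then obtain V where V: "openin T V" "U = f -` V \<inter> A" "l \<in> U"
    by (auto simp: openin_pullback_topology)
  then have "\<forall>\<^sub>F t in F. f (g t) \<in> V"
    using assms(3) by (simp add: limitin_def)
  with assms(2) show "\<forall>\<^sub>F t in F. g t \<in> U"
    by eventually_elim (simp add: V)
qed

lemma limitin_sequentially_closure_of:
  assumes "limitin X f l sequentially" "\<And>n::nat. f n \<in> S"
  shows "l \<in> X closure_of S"
  unfolding in_closure_of
proof (intro conjI allI impI)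
  show "l \<in> topspace X" using assms(1) by (rule limitin_topspace)
  fix T assume "l \<in> T \<and> openin X T"
  then have "\<forall>\<^sub>F n in sequentially. f n \<in> T"
    using assms(1) by (simp add: limitin_def)
  then show "\<exists>y. y \<in> S \<and> y \<in> T"
    using assms(2) eventually_happens'[OF sequentially_bot] by blast
qed

text \<open>Boundedness makes up for the missing joint weak continuity: v . (w - w0) is at most B |w
  - w0|, and v . w0 involves a fixed vector only. This is the source of the joint continuity of the
  action.\<close>

lemma continuous_map_weak_inner:
  fixes v w :: "'c \<Rightarrow> 'b::real_inner"
  assumes v: "\<And>y. continuous_map X euclideanreal (\<lambda>t. v t \<bullet> y)"
    and bound: "\<And>t. t \<in> topspace X \<Longrightarrow> norm (v t) \<le> B"
    and w: "continuous_map X euclidean w"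
  shows "continuous_map X euclideanreal (\<lambda>t. v t \<bullet> w t)"
  unfolding continuous_map_euclidean_tendsto
proof
  fix t0 assume t0: "t0 \<in> topspace X"
  let ?F = "atin X t0"
  have wt: "(w \<longlongrightarrow> w t0) ?F"
    using w t0 by (simp add: continuous_map_euclidean_tendsto)
  have "((\<lambda>t. B * norm (w t - w t0)) \<longlongrightarrow> B * norm (w t0 - w t0)) ?F"
    by (intro tendsto_intros wt)
  then have lim: "((\<lambda>t. B * norm (w t - w t0)) \<longlongrightarrow> 0) ?F" by simp
  have "((\<lambda>t. v t \<bullet> (w t - w t0)) \<longlongrightarrow> 0) ?F"
  proof (rule Lim_null_comparison[OF _ lim])
    have "norm (v t \<bullet> (w t - w t0)) \<le> B * norm (w t - w t0)" if "t \<in> topspace X" for t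
      using Cauchy_Schwarz_ineq2[of "v t" "w t - w t0"] mult_right_mono[OF bound[OF that], of "norm (w t - w t0)"]
      by simp
    then show "\<forall>\<^sub>F t in ?F. norm (v t \<bullet> (w t - w t0)) \<le> B * norm (w t - w t0)"
      by (auto simp: eventually_atin)
  qed
  moreover have "((\<lambda>t. v t \<bullet> w t0) \<longlongrightarrow> v t0 \<bullet> w t0) ?F"
    using v[of "w t0"] t0 by (simp add: continuous_map_euclidean_tendsto)
  ultimately have "((\<lambda>t. v t \<bullet> (w t - w t0) + v t \<bullet> w t0) \<longlongrightarrow> 0 + v t0 \<bullet> w t0) ?F"
    by (rule tendsto_add)
  then show "((\<lambda>t. v t \<bullet> w t) \<longlongrightarrow> v t0 \<bullet> w t0) ?F"
    by (simp add: inner_diff_right)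
qed

section \<open>Borel sets of a topology\<close>

lemma space_borel_measure_of [simp]: "space (borel_measure_of X) = topspace X"
  unfolding borel_measure_of_def by (rule space_measure_of) (auto dest: openin_subset)

lemma openin_borel_measure_of: "openin X U \<Longrightarrow> U \<in> sets (borel_measure_of X)"
  unfolding borel_measure_of_def by (subst sets_measure_of) (auto dest: openin_subset)

lemma closedin_borel_measure_of:
  assumes "closedin X C"
  shows "C \<in> sets (borel_measure_of X)"
proof -
  have "space (borel_measure_of X) - (topspace X - C) \<in> sets (borel_measure_of X)"
    using assms by (intro sets.compl_sets openin_borel_measure_of) (simp add: closedin_def)
  moreover have "topspace X - (topspace X - C) = C"
    using closedin_subset[OF assms] by auto
  ultimately show ?thesis by simp
qed

lemma continuous_map_measurable:
  assumes "continuous_map X Y f"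
  shows "f \<in> measurable (borel_measure_of X) (borel_measure_of Y)"
proof -
  have "f \<in> measurable (borel_measure_of X) (sigma (topspace Y) {U. openin Y U})"
  proof (rule measurable_measure_of)
    show "f -` U \<inter> space (borel_measure_of X) \<in> sets (borel_measure_of X)"
      if "U \<in> {U. openin Y U}" for U
    proof -
      have "f -` U \<inter> topspace X = {x \<in> topspace X. f x \<in> U}" by auto
      then show ?thesis
        using assms that by (simp add: openin_borel_measure_of openin_continuous_map_preimage)
    qed
  qed (use continuous_map_funspace[OF assms] in \<open>auto dest: openin_subset\<close>)
  then show ?thesis by (simp add: borel_measure_of_def)
qed

lemma continuous_map_real_measurable:
  assumes "continuous_map X euclideanreal f"
  shows "f \<in> borel_measurable (borel_measure_of X)"
proof (rule borel_measurableI)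
  fix U :: "real set" assume "open U"
  have "f -` U \<inter> topspace X = {x \<in> topspace X. f x \<in> U}" by auto
  then show "f -` U \<inter> space (borel_measure_of X) \<in> sets (borel_measure_of X)"
    using assms \<open>open U\<close> by (simp add: openin_borel_measure_of openin_continuous_map_preimage)
qed

section \<open>Expansions in a Hilbert basis, Riesz-Fischer and Riesz representation\<close>

locale hyperbolic_model =
  fixes e :: "nat \<Rightarrow> 'a::{real_inner, complete_space}"
  assumes basis: "hilbert_basis e"
begin

lemma e_inner: "e i \<bullet> e j = (if i = j then 1 else 0)"
  using basis by (simp add: hilbert_basis_def)

lemma norm_e [simp]: "norm (e i) = 1"
  by (simp add: norm_eq_sqrt_inner e_inner)

lemma e_total: "x \<in> closure (span (range e))"
  using basis by (simp add: hilbert_basis_def)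

lemma inner_sum_e: "(\<Sum>i\<in>A. a i *\<^sub>R e i) \<bullet> e j = (if j \<in> A then a j else 0)" if "finite A"
  using that by (simp add: inner_sum_left e_inner if_distrib[of "\<lambda>x. _ * x"] sum.delta cong: if_cong)

lemma norm_sum_e: "(norm (\<Sum>i\<in>A. a i *\<^sub>R e i))\<^sup>2 = (\<Sum>i\<in>A. (a i)\<^sup>2)" if "finite A"
proof -
  have "(norm (\<Sum>i\<in>A. a i *\<^sub>R e i))\<^sup>2 = (\<Sum>i\<in>A. a i * ((\<Sum>i\<in>A. a i *\<^sub>R e i) \<bullet> e i))"
    unfolding power2_norm_eq_inner by (simp add: inner_sum_right)
  also have "\<dots> = (\<Sum>i\<in>A. (a i)\<^sup>2)"
    by (intro sum.cong) (simp_all add: inner_sum_e that power2_eq_square)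
  finally show ?thesis .
qed

lemma Bessel: "(\<Sum>i\<in>A. (x \<bullet> e i)\<^sup>2) \<le> (norm x)\<^sup>2" if "finite A"
proof -
  let ?p = "\<Sum>i\<in>A. (x \<bullet> e i) *\<^sub>R e i"
  have "x \<bullet> ?p = (\<Sum>i\<in>A. (x \<bullet> e i)\<^sup>2)"
    by (simp add: inner_sum_right power2_eq_square)
  moreover have "0 \<le> (norm (x - ?p))\<^sup>2" by simp
  ultimately show ?thesis
    using norm_sum_e[OF that, of "\<lambda>i. x \<bullet> e i"]
    by (simp add: power2_norm_eq_inner inner_diff_left inner_diff_right inner_commute)
qed

text \<open>The partial sums are contractions by Bessel and are eventually constant on each basis
  vector, so totality of the basis suffices.\<close>

lemma expansion: "(\<lambda>n. \<Sum>i<n. (x \<bullet> e i) *\<^sub>R e i) \<longlonglongrightarrow> x"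
proof -
  have "((\<lambda>n. (\<lambda>n x. \<Sum>i<n. (x \<bullet> e i) *\<^sub>R e i) n x) \<longlongrightarrow> (\<lambda>x. x) x) sequentially"
  proof (rule tendsto_closure_span[where B = 1 and S = "range e"])
    show "\<forall>\<^sub>F n in sequentially. linear (\<lambda>x. \<Sum>i<n. (x \<bullet> e i) *\<^sub>R e i) \<and>
        (\<forall>x. norm (\<Sum>i<n. (x \<bullet> e i) *\<^sub>R e i) \<le> 1 * norm x)"
    proof (intro always_eventually allI conjI)
      fix n
      show "linear (\<lambda>x. \<Sum>i<n. (x \<bullet> e i) *\<^sub>R e i)"
        by (rule linearI) (simp_all add: inner_add_left scaleR_add_left sum.distrib scaleR_sum_right)
      show "norm (\<Sum>i<n. (x \<bullet> e i) *\<^sub>R e i) \<le> 1 * norm x" for x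
        using Bessel[of "{..<n}" x] norm_sum_e[of "{..<n}" "\<lambda>i. x \<bullet> e i"]
        by (simp add: power2_le_imp_le)
    qed
    show "linear (\<lambda>x::'a. x)" by (simp add: linear_iff)
    show "(\<lambda>n. \<Sum>i<n. (s \<bullet> e i) *\<^sub>R e i) \<longlonglongrightarrow> s" if s: "s \<in> range e" for s
    proof -
      obtain j where j: "s = e j" using s by auto
      have "(\<Sum>i<n. (s \<bullet> e i) *\<^sub>R e i) = s" if "n > j" for n
        using that by (simp add: j e_inner if_distrib[of "\<lambda>x. x *\<^sub>R _"] sum.delta' cong: if_cong)
      then show ?thesis
        by (intro tendsto_eventually eventually_mono[OF eventually_gt_at_top[of j]])
    qed
  qed (simp_all add: e_total)
  then show ?thesis by simp
qed

lemma Parseval: "(\<lambda>i. (x \<bullet> e i)\<^sup>2) sums (norm x)\<^sup>2"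
proof -
  have "(\<lambda>n. (norm (\<Sum>i<n. (x \<bullet> e i) *\<^sub>R e i))\<^sup>2) \<longlonglongrightarrow> (norm x)\<^sup>2"
    by (intro tendsto_intros expansion)
  then show ?thesis
    by (simp add: sums_def norm_sum_e)
qed

lemma eq_if_inner_e: "x = y" if "\<And>i. x \<bullet> e i = y \<bullet> e i"
proof -
  have "(\<lambda>i. 0) sums (norm (x - y))\<^sup>2"
    using Parseval[of "x - y"] that by (simp add: inner_diff_left)
  then have "(norm (x - y))\<^sup>2 = 0"
    using sums_unique2 sums_zero by blast
  then show ?thesis by simp
qed

text \<open>Completeness of the space enters here. Bounding the partial sums, rather than assuming
  summability, is a closed condition on the coefficients, and \<open>coords_image\<close> needs it
  in that form.\<close>

lemma Riesz_Fischer: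
  assumes "\<And>n. (\<Sum>i<n. (a i)\<^sup>2) \<le> B"
  obtains x where "\<And>i. x \<bullet> e i = a i" "(norm x)\<^sup>2 \<le> B"
proof -
  let ?s = "\<lambda>n. \<Sum>i<n. a i *\<^sub>R e i"
  have "summable (\<lambda>i. (a i)\<^sup>2)"
    by (rule summableI_nonneg_bounded[of _ B]) (use assms in auto)
  then have C: "Cauchy (\<lambda>n. \<Sum>i<n. (a i)\<^sup>2)"
    by (simp add: summable_iff_convergent convergent_Cauchy)
  have "Cauchy ?s"
  proof (rule CauchyI)
    fix \<epsilon> :: real assume "\<epsilon> > 0"
    then obtain M where M: "\<And>m n. m \<ge> M \<Longrightarrow> n \<ge> M \<Longrightarrow>
        \<bar>(\<Sum>i<m. (a i)\<^sup>2) - (\<Sum>i<n. (a i)\<^sup>2)\<bar> < \<epsilon>\<^sup>2"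
      using CauchyD[OF C, of "\<epsilon>\<^sup>2"] by auto
    have *: "norm (?s m - ?s n) < \<epsilon>" if "m \<ge> n" "n \<ge> M" for m n
    proof -
      have split: "(\<Sum>i<m. h i) - (\<Sum>i<n. h i) = (\<Sum>i\<in>{n..<m}. h i)" for h :: "nat \<Rightarrow> 'c::ab_group_add"
        using that by (metis atLeast0LessThan sum_diff_nat_ivl zero_le)
      have "(norm (?s m - ?s n))\<^sup>2 < \<epsilon>\<^sup>2"
        unfolding split using M[of m n] that by (simp add: norm_sum_e split)
      then show ?thesis
        using \<open>\<epsilon> > 0\<close> by (simp add: power_less_imp_less_base)
    qed
    show "\<exists>M. \<forall>m\<ge>M. \<forall>n\<ge>M. norm (?s m - ?s n) < \<epsilon>"
    proof (intro exI allI impI)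
      fix m n assume "M \<le> m" "M \<le> n"
      then show "norm (?s m - ?s n) < \<epsilon>"
        using *[of m n] *[of n m] by (cases "m \<ge> n") (auto simp: norm_minus_commute)
    qed
  qed
  then obtain x where x: "?s \<longlonglongrightarrow> x"
    using Cauchy_convergent convergent_def by blast
  show ?thesis
  proof
    fix i
    have "(\<lambda>n. ?s n \<bullet> e i) \<longlonglongrightarrow> x \<bullet> e i"
      by (intro tendsto_intros x)
    moreover have "(\<lambda>n. ?s n \<bullet> e i) \<longlonglongrightarrow> a i"
      by (intro tendsto_eventually eventually_mono[OF eventually_gt_at_top[of i]]) (simp add: inner_sum_e)
    ultimately show "x \<bullet> e i = a i" by (rule LIMSEQ_unique)
  next
    have "(\<lambda>n. (norm (?s n))\<^sup>2) \<longlonglongrightarrow> (norm x)\<^sup>2"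
      by (intro tendsto_intros x)
    then show "(norm x)\<^sup>2 \<le> B"
      using assms by (intro LIMSEQ_le_const2) (auto simp: norm_sum_e)
  qed
qed

lemma Riesz_representation:
  fixes f :: "'a \<Rightarrow>\<^sub>L real"
  obtains y where "\<And>x. blinfun_apply f x = x \<bullet> y"
proof -
  have "(\<Sum>i<n. (f (e i))\<^sup>2) \<le> (norm f)\<^sup>2" for n
  proof (cases "(\<Sum>i<n. (f (e i))\<^sup>2) = 0")
    case False
    let ?S = "\<Sum>i<n. (f (e i))\<^sup>2"
    have S: "?S > 0" using False by (simp add: sum_nonneg order.not_eq_order_implies_strict)
    \<comment> \<open>Testing \<open>f\<close> on this vector gives S = f v with |v|^2 = S, so S is
      at most |f| sqrt S, which yields the bound |f|^2.\<close>
    let ?v = "\<Sum>i<n. f (e i) *\<^sub>R e i"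
    have "?S = f ?v"
      by (simp add: blinfun.sum_right blinfun.scaleR_right power2_eq_square)
    also have "\<dots> \<le> norm f * norm ?v"
      using norm_blinfun[of f ?v] by simp
    finally have "?S\<^sup>2 \<le> (norm f * norm ?v)\<^sup>2"
      using S by (intro power_mono) auto
    then have "?S * ?S \<le> (norm f)\<^sup>2 * ?S"
      by (simp add: power_mult_distrib norm_sum_e power2_eq_square[of ?S])
    then show ?thesis
      using S by simp
  qed simp
  then obtain y where y: "\<And>i. y \<bullet> e i = f (e i)"
    using Riesz_Fischer[of "\<lambda>i. f (e i)" "(norm f)\<^sup>2"] by metis
  have "f x = x \<bullet> y" for x
  proof -
    \<comment> \<open>A constant family: convergence of the constant \<open>f x\<close> to x . y is
      equality, so the density lemma also serves as a uniqueness principle.\<close>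
    have "((\<lambda>n. f x) \<longlongrightarrow> x \<bullet> y) sequentially"
    proof (rule tendsto_closure_span[where S = "range e" and B = "max (norm f) (norm y)" and f = "\<lambda>_. f"])
      show "norm (x \<bullet> y) \<le> max (norm f) (norm y) * norm x" for x
      proof -
        have "norm (x \<bullet> y) \<le> norm y * norm x" using Cauchy_Schwarz_ineq2[of x y] by (simp add: mult.commute)
        also have "\<dots> \<le> max (norm f) (norm y) * norm x" by (intro mult_right_mono) auto
        finally show ?thesis .
      qed
      show "\<forall>\<^sub>F c in sequentially. linear f \<and> (\<forall>x. norm (f x) \<le> max (norm f) (norm y) * norm x)"
      proof (intro always_eventually allI conjI)
        show "linear f" by (simp add: blinfun.bounded_linear_right bounded_linear.linear)
        fix x
        have "norm (f x) \<le> norm f * norm x" by (rule norm_blinfun)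
        also have "\<dots> \<le> max (norm f) (norm y) * norm x" by (intro mult_right_mono) auto
        finally show "norm (f x) \<le> max (norm f) (norm y) * norm x" .
      qed
      show "linear (\<lambda>x. x \<bullet> y)"
        by (rule linearI) (auto simp: inner_add_left)
    qed (use y e_total in \<open>auto simp: inner_commute\<close>)
    then show ?thesis by (simp add: LIMSEQ_const_iff)
  qed
  then show thesis using that by blast
qed

section \<open>The quadratic form\<close>

text \<open>The symmetry that is +1 on \<open>e 0\<close> and -1 on its orthogonal complement. It
  relates the form to the inner product, so the inverse of an isometry is J g* J, with g* the
  Hilbert adjoint.\<close>

definition J :: "'a \<Rightarrow> 'a" where
  "J x = (2 * (x \<bullet> e 0)) *\<^sub>R e 0 - x"

lemma Q_eq: "Q e x = 2 * (x \<bullet> e 0)\<^sup>2 - (norm x)\<^sup>2"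
proof -
  have "(\<lambda>i. (x \<bullet> e (Suc i))\<^sup>2) sums ((norm x)\<^sup>2 - (x \<bullet> e 0)\<^sup>2)"
    using Parseval[of x] by (subst sums_Suc_iff) simp
  then have "(\<Sum>i. (x \<bullet> e (Suc i))\<^sup>2) = (norm x)\<^sup>2 - (x \<bullet> e 0)\<^sup>2"
    by (rule sums_unique[symmetric])
  then show ?thesis unfolding Q_def by simp
qed

lemma bil_eq_inner: "bil e x y = J x \<bullet> y"
  unfolding bil_def Q_eq J_def power2_norm_eq_inner
  by (simp add: inner_add_left inner_add_right inner_diff_left inner_commute[of "e 0"]
      inner_commute[of y x] power2_eq_square field_simps)

lemma bil_eq: "bil e x y = 2 * (x \<bullet> e 0) * (y \<bullet> e 0) - x \<bullet> y"
  unfolding bil_eq_inner J_def by (simp add: inner_diff_left inner_commute[of "e 0"])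

lemma Q_bil: "Q e x = bil e x x"
  unfolding Q_eq bil_eq power2_norm_eq_inner by (simp add: power2_eq_square)

lemma bil_commute: "bil e x y = bil e y x"
  by (simp add: bil_eq inner_commute)

lemma bil_simps:
  "bil e (x + y) z = bil e x z + bil e y z" "bil e x (y + z) = bil e x y + bil e x z"
  "bil e (x - y) z = bil e x z - bil e y z" "bil e x (y - z) = bil e x y - bil e x z"
  "bil e (a *\<^sub>R x) y = a * bil e x y" "bil e x (a *\<^sub>R y) = a * bil e x y"
  "bil e (- x) y = - bil e x y" "bil e x (- y) = - bil e x y"
  "bil e 0 y = 0" "bil e x 0 = 0"
  by (simp_all add: bil_eq inner_add_left inner_add_right inner_diff_left inner_diff_right
      algebra_simps)

lemma J_J [simp]: "J (J x) = x"
  by (simp add: J_def inner_diff_left e_inner)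

lemma J_inner: "J x \<bullet> y = x \<bullet> J y"
  by (simp add: J_def inner_diff_left inner_diff_right inner_commute)

lemma inner_eq_bil: "x \<bullet> y = bil e x (J y)"
  by (simp add: bil_eq_inner J_inner)

lemma norm_J [simp]: "norm (J x) = norm x"
  by (simp add: norm_eq_sqrt_inner J_inner)

lemma linear_J: "linear J"
  by (rule linearI) (simp_all add: J_def inner_add_left algebra_simps)

lemma bounded_linear_J: "bounded_linear J"
  by (rule bounded_linear_intro[where K = 1]) (simp_all add: linear_J linear_add linear_scale)

lemma bil_e0: "bil e x (e 0) = x \<bullet> e 0"
  by (simp add: bil_eq e_inner)

lemma bil_le_norm: "\<bar>bil e x y\<bar> \<le> norm x * norm y"
  using Cauchy_Schwarz_ineq2[of "J x" y] by (simp add: bil_eq_inner)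

lemma abs_Q_le: "\<bar>Q e x\<bar> \<le> (norm x)\<^sup>2"
  using bil_le_norm[of x x] by (simp add: Q_bil power2_eq_square)

lemma norm_eq_Q: "(norm x)\<^sup>2 = 2 * (x \<bullet> e 0)\<^sup>2 - Q e x"
  by (simp add: Q_eq)

text \<open>Cauchy-Schwarz for the components orthogonal to \<open>e 0\<close>, whose norms are the
  two square roots. The lower bound gives the time orientation; on the hyperboloid the upper bound
  is the addition formula for cosh.\<close>

lemma bil_bounds:
  assumes "x \<bullet> e 0 \<ge> 0" "y \<bullet> e 0 \<ge> 0"
  shows "bil e x y \<ge> (x \<bullet> e 0) * (y \<bullet> e 0)
    - sqrt ((x \<bullet> e 0)\<^sup>2 - Q e x) * sqrt ((y \<bullet> e 0)\<^sup>2 - Q e y)"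
    and "bil e x y \<le> (x \<bullet> e 0) * (y \<bullet> e 0)
    + sqrt ((x \<bullet> e 0)\<^sup>2 - Q e x) * sqrt ((y \<bullet> e 0)\<^sup>2 - Q e y)"
proof -
  define p where "p z = z - (z \<bullet> e 0) *\<^sub>R e 0" for z
  have norm_p: "norm (p z) = sqrt ((z \<bullet> e 0)\<^sup>2 - Q e z)" for z
    unfolding norm_eq_sqrt_inner Q_eq
    by (simp add: p_def power2_norm_eq_inner inner_diff_left inner_diff_right e_inner inner_commute power2_eq_square)
  have "bil e x y = (x \<bullet> e 0) * (y \<bullet> e 0) - p x \<bullet> p y"
    by (simp add: bil_eq p_def inner_diff_left inner_diff_right e_inner inner_commute)
  then show "bil e x y \<ge> (x \<bullet> e 0) * (y \<bullet> e 0)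
    - sqrt ((x \<bullet> e 0)\<^sup>2 - Q e x) * sqrt ((y \<bullet> e 0)\<^sup>2 - Q e y)"
    and "bil e x y \<le> (x \<bullet> e 0) * (y \<bullet> e 0)
    + sqrt ((x \<bullet> e 0)\<^sup>2 - Q e x) * sqrt ((y \<bullet> e 0)\<^sup>2 - Q e y)"
    using Cauchy_Schwarz_ineq2[of "p x" "p y"] by (auto simp: norm_p)
qed

lemma bil_pos:
  assumes "Q e x \<ge> 0" "x \<bullet> e 0 > 0" "Q e u > 0" "u \<bullet> e 0 > 0"
  shows "bil e x u > 0"
proof -
  have "sqrt ((x \<bullet> e 0)\<^sup>2 - Q e x) \<le> x \<bullet> e 0"
    using assms by (simp add: real_le_lsqrt real_sqrt_le_iff sqrt_le_D)
  moreover have "sqrt ((u \<bullet> e 0)\<^sup>2 - Q e u) < u \<bullet> e 0"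
    using assms real_less_lsqrt by auto
  moreover have "sqrt ((u \<bullet> e 0)\<^sup>2 - Q e u) \<ge> 0"
    using Bessel[of "{0}" u] by (simp add: Q_eq)
  ultimately have "sqrt ((x \<bullet> e 0)\<^sup>2 - Q e x) * sqrt ((u \<bullet> e 0)\<^sup>2 - Q e u) < (x \<bullet> e 0) * (u \<bullet> e 0)"
    using assms(2) by (smt (verit) mult_left_mono mult_right_mono mult_strict_left_mono)
  then show ?thesis
    using bil_bounds(1)[of x u] assms by linarith
qed

section \<open>The isometry group\<close>

abbreviation gi :: "('a \<Rightarrow> 'a) \<Rightarrow> 'a \<Rightarrow> 'a" where
  "gi g \<equiv> inv_into UNIV g"

lemma O1inf_iff:
  "g \<in> carrier (O1inf e) \<longleftrightarrow> bounded_linear g \<and> bij g \<and> (\<forall>x. Q e (g x) = Q e x)"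
  by (simp add: O1inf_def)

lemma O1inf_mult [simp]: "g \<otimes>\<^bsub>O1inf e\<^esub> h = g \<circ> h"
  by (simp add: O1inf_def)

lemma O1inf_one [simp]: "\<one>\<^bsub>O1inf e\<^esub> = id"
  by (simp add: O1inf_def)

lemma O1inf_linear: "g \<in> carrier (O1inf e) \<Longrightarrow> linear g"
  by (simp add: O1inf_iff bounded_linear.linear)

lemma O1inf_gi [simp]:
  assumes "g \<in> carrier (O1inf e)"
  shows "g (gi g x) = x" "gi g (g x) = x"
  using assms by (simp_all add: O1inf_iff bij_is_surj bij_is_inj surj_f_inv_f)

lemma O1inf_bil: "bil e (g x) (g y) = bil e x y" if "g \<in> carrier (O1inf e)"
  using that unfolding bil_def O1inf_iff
  by (metis bounded_linear.linear linear_add)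

lemma bil_gi: "bil e (g x) y = bil e x (gi g y)" if "g \<in> carrier (O1inf e)"
  using O1inf_bil[OF that, of x "gi g y"] that by simp

text \<open>By \<open>norm_eq_Q\<close>, only the \<open>e 0\<close>-coordinate of
  \<open>g x\<close> has to be bounded, as \<open>Q\<close> is preserved. That coordinate is the
  form between \<open>x\<close> and the single vector \<open>gi g (e 0)\<close>.\<close>

lemma norm_O1inf_le: "(norm (g x))\<^sup>2 \<le> (2 * (norm (gi g (e 0)))\<^sup>2 + 1) * (norm x)\<^sup>2"
  if "g \<in> carrier (O1inf e)"
proof -
  have "g x \<bullet> e 0 = bil e x (gi g (e 0))"
    using bil_gi[OF that] by (simp add: bil_e0[symmetric])
  then have "(g x \<bullet> e 0)\<^sup>2 \<le> (norm x * norm (gi g (e 0)))\<^sup>2"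
    by (metis abs_ge_zero bil_le_norm power2_abs power_mono)
  moreover have "Q e (g x) = Q e x"
    using that by (simp add: O1inf_iff)
  ultimately show ?thesis
    using norm_eq_Q[of "g x"] abs_Q_le[of x]
    by (simp add: power_mult_distrib algebra_simps)
qed

text \<open>The inverse is bounded by the same estimate with the roles exchanged: the
  \<open>e 0\<close>-coordinate of \<open>gi g x\<close> is the form between \<open>x\<close> and
  \<open>g (e 0)\<close>.\<close>

lemma O1inf_gi_closed: "gi g \<in> carrier (O1inf e)" if g: "g \<in> carrier (O1inf e)"
proof -
  have lin: "linear (gi g)"
  proof (rule linearI)
    show "gi g (x + y) = gi g x + gi g y" for x y
      using O1inf_gi[OF g] linear_add[OF O1inf_linear[OF g], of "gi g x" "gi g y"] by metis
    show "gi g (a *\<^sub>R x) = a *\<^sub>R gi g x" for a x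
      using O1inf_gi[OF g] linear_scale[OF O1inf_linear[OF g], of a "gi g x"] by metis
  qed
  have gg: "gi (gi g) = g"
    using g by (simp add: O1inf_iff inv_inv_eq)
  have pres: "Q e (gi g x) = Q e x" for x
    using g by (metis O1inf_gi(1) O1inf_iff)
  have "(norm (gi g x))\<^sup>2 \<le> (2 * (norm (g (e 0)))\<^sup>2 + 1) * (norm x)\<^sup>2" for x
  proof -
    have "gi g x \<bullet> e 0 = bil e x (g (e 0))"
      using bil_gi[OF g, of "e 0" x] by (simp add: bil_e0[symmetric] bil_commute)
    then have "(gi g x \<bullet> e 0)\<^sup>2 \<le> (norm x * norm (g (e 0)))\<^sup>2"
      by (metis abs_ge_zero bil_le_norm power2_abs power_mono)
    then show ?thesis
      using norm_eq_Q[of "gi g x"] abs_Q_le[of x] pres[of x]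
      by (simp add: power_mult_distrib algebra_simps)
  qed
  then have "norm (gi g x) \<le> norm x * sqrt (2 * (norm (g (e 0)))\<^sup>2 + 1)" for x
    by (metis mult.commute norm_ge_zero real_le_rsqrt real_sqrt_abs real_sqrt_mult abs_norm_cancel)
  then have "bounded_linear (gi g)"
    using lin by (intro bounded_linear_intro) (auto simp: linear_add linear_scale)
  then show ?thesis
    using g pres by (simp add: O1inf_iff bij_imp_bij_inv)
qed

lemma group_O1inf: "group (O1inf e)"
proof (rule groupI)
  show "x \<otimes>\<^bsub>O1inf e\<^esub> y \<in> carrier (O1inf e)"
    if "x \<in> carrier (O1inf e)" "y \<in> carrier (O1inf e)" for x y
    using that bij_comp[of y x] bounded_linear_compose[of x y] unfolding O1inf_mult O1inf_iff
    by (auto simp: comp_def)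
  show "\<one>\<^bsub>O1inf e\<^esub> \<in> carrier (O1inf e)"
    by (simp add: O1inf_iff bounded_linear_ident id_def bij_id[unfolded id_def])
  show "\<exists>y\<in>carrier (O1inf e). y \<otimes>\<^bsub>O1inf e\<^esub> x = \<one>\<^bsub>O1inf e\<^esub>" if "x \<in> carrier (O1inf e)" for x
    using that O1inf_gi_closed[OF that] by (intro bexI[of _ "gi x"]) (auto simp: fun_eq_iff)
qed (auto simp: comp_assoc)

lemma uminus_comp_closed: "uminus \<circ> g \<in> carrier (O1inf e)" if "g \<in> carrier (O1inf e)"
proof -
  have "bij (uminus \<circ> g)"
    using that bij_comp[of g uminus] by (simp add: O1inf_iff bij_uminus)
  then show ?thesis
    using that by (auto simp: O1inf_iff comp_def bounded_linear_minus Q_bil bil_simps)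
qed

section \<open>Passage to the quotient by the sign and forward representatives\<close>

definition coset :: "('a \<Rightarrow> 'a) \<Rightarrow> ('a \<Rightarrow> 'a) set" where
  "coset g = {g, uminus \<circ> g}"

lemma r_coset_eq: "{id, uminus} #>\<^bsub>O1inf e\<^esub> g = coset g"
  by (auto simp: r_coset_def coset_def)

lemma normal_pm: "{id, uminus} \<lhd> O1inf e"
proof -
  interpret group "O1inf e" by (rule group_O1inf)
  have u: "uminus \<in> carrier (O1inf e)"
    using uminus_comp_closed[OF one_closed] by simp
  have uu: "uminus \<circ> uminus = (id :: 'a \<Rightarrow> 'a)"
    by (simp add: fun_eq_iff)
  show ?thesis
  proof (rule normalI)
    show "subgroup {id, uminus} (O1inf e)"
    proof (rule subgroupI)
      show "inv\<^bsub>O1inf e\<^esub> a \<in> {id, uminus}" if "a \<in> {id, uminus}" for a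
      proof -
        have "inv\<^bsub>O1inf e\<^esub> a = a"
          using that u one_closed by (intro inv_equality) (auto simp: uu)
        then show ?thesis using that by simp
      qed
    qed (use u one_closed in \<open>auto simp: uu\<close>)
    show "\<forall>x\<in>carrier (O1inf e). {id, uminus} #>\<^bsub>O1inf e\<^esub> x = x <#\<^bsub>O1inf e\<^esub> {id, uminus}"
      unfolding r_coset_eq
      by (auto simp: coset_def l_coset_def fun_eq_iff dest!: O1inf_linear simp: linear_neg)
  qed
qed

lemma group_Isom: "group (Isom_hyp e)"
  unfolding Isom_hyp_def by (rule normal.factorgroup_is_group[OF normal_pm])

lemma carrier_Isom: "carrier (Isom_hyp e) = coset ` carrier (O1inf e)"
  by (auto simp: Isom_hyp_def FactGroup_def RCOSETS_def r_coset_eq)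

lemma Isom_mult:
  "coset g \<otimes>\<^bsub>Isom_hyp e\<^esub> coset h = coset (g \<circ> h)"
  if "g \<in> carrier (O1inf e)" "h \<in> carrier (O1inf e)"
  using normal.rcos_sum[OF normal_pm that] by (simp add: Isom_hyp_def r_coset_eq)

lemma Isom_one: "\<one>\<^bsub>Isom_hyp e\<^esub> = coset id"
  by (simp add: Isom_hyp_def FactGroup_def coset_def fun_eq_iff)

definition O_plus :: "('a \<Rightarrow> 'a) set" where
  "O_plus = {g \<in> carrier (O1inf e). g (e 0) \<bullet> e 0 > 0}"

lemma O_plus_O1inf: "g \<in> O_plus \<Longrightarrow> g \<in> carrier (O1inf e)"
  by (simp add: O_plus_def)

lemma Q_e0: "Q e (e 0) = 1"
  by (simp add: Q_eq e_inner)

lemma forward_nonzero: "v \<bullet> e 0 \<noteq> 0" if "Q e v \<ge> 0" "v \<noteq> 0"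
proof
  assume "v \<bullet> e 0 = 0"
  then show False using that by (simp add: Q_eq)
qed

text \<open>If \<open>g v\<close> pointed backward, - g v and \<open>g (e 0)\<close> would pair
  positively by \<open>bil_pos\<close>. But invariance gives this pairing the value - v_0, which is
  negative.\<close>

lemma O_plus_forward:
  assumes g: "g \<in> O_plus" and v: "Q e v \<ge> 0" "v \<bullet> e 0 > 0"
  shows "g v \<bullet> e 0 > 0"
proof (rule ccontr)
  assume *: "\<not> ?thesis"
  have O: "g \<in> carrier (O1inf e)" and g0: "g (e 0) \<bullet> e 0 > 0"
    using g by (auto simp: O_plus_def)
  have Qg: "Q e (g x) = Q e x" for x using O by (simp add: O1inf_iff)
  have "g v \<noteq> 0"
    using v(2) O1inf_gi(2)[OF O, of v] O1inf_gi(2)[OF O, of 0] linear_0[OF O1inf_linear[OF O]] by force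
  then have "- g v \<bullet> e 0 > 0"
    using forward_nonzero[of "g v"] * v Qg by auto
  then have "bil e (- g v) (g (e 0)) > 0"
    using v Qg Q_e0 g0 by (intro bil_pos) (auto simp: Q_bil bil_simps)
  then show False
    using v(2) by (simp add: bil_simps O1inf_bil[OF O] bil_e0)
qed

lemma O_plus_comp: "g \<circ> h \<in> O_plus" if "g \<in> O_plus" "h \<in> O_plus"
proof -
  interpret group "O1inf e" by (rule group_O1inf)
  show ?thesis
    using that O_plus_forward[OF that(1), of "h (e 0)"] m_closed[of g h]
    by (auto simp: O_plus_def O1inf_iff Q_e0)
qed

lemma O_plus_gi: "gi g \<in> O_plus" if "g \<in> O_plus"
  using that bil_gi[of g "e 0" "e 0"]
  by (auto simp: O_plus_def O1inf_gi_closed bil_e0 bil_commute[of "e 0"])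

lemma O_plus_id: "id \<in> O_plus"
proof -
  interpret group "O1inf e" by (rule group_O1inf)
  show ?thesis using one_closed by (simp add: O_plus_def e_inner)
qed

lemma O_plus_cases:
  assumes "g \<in> carrier (O1inf e)"
  obtains "g \<in> O_plus" "uminus \<circ> g \<notin> O_plus" | "uminus \<circ> g \<in> O_plus" "g \<notin> O_plus"
proof -
  have "Q e (g (e 0)) = 1" using assms by (simp add: O1inf_iff Q_e0)
  then have "g (e 0) \<bullet> e 0 \<noteq> 0"
    using forward_nonzero[of "g (e 0)"] by (metis Q_bil bil_simps(9) zero_le_one zero_neq_one)
  then show thesis
    using that assms uminus_comp_closed[OF assms] by (fastforce simp: O_plus_def)
qed

text \<open>\<open>O_plus\<close> is a subgroup that meets each class once, so this choice of
  representatives is multiplicative and the quotient can be computed with maps.\<close>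

definition pr :: "('a \<Rightarrow> 'a) set \<Rightarrow> 'a \<Rightarrow> 'a" where
  "pr c = (THE g. g \<in> c \<and> g \<in> O_plus)"

lemma pr_coset: "pr (coset g) = g" if "g \<in> O_plus"
proof -
  have "h = g" if "h \<in> coset g" "h \<in> O_plus" for h
    using that \<open>g \<in> O_plus\<close> O_plus_cases[OF O_plus_O1inf[OF \<open>g \<in> O_plus\<close>]] by (auto simp: coset_def)
  then show ?thesis
    unfolding pr_def using that by (intro the_equality) (auto simp: coset_def)
qed

lemma coset_uminus: "coset (uminus \<circ> g) = coset g"
  by (auto simp: coset_def fun_eq_iff)

lemma Isom_obtain:
  assumes "c \<in> carrier (Isom_hyp e)"
  obtains g where "g \<in> O_plus" "c = coset g"
  using assms O_plus_cases coset_uminus unfolding carrier_Isom by (metis imageE)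

lemma pr_O_plus: "c \<in> carrier (Isom_hyp e) \<Longrightarrow> pr c \<in> O_plus"
  by (metis Isom_obtain pr_coset)

lemma pr_O1inf: "c \<in> carrier (Isom_hyp e) \<Longrightarrow> pr c \<in> carrier (O1inf e)"
  by (simp add: pr_O_plus O_plus_O1inf)

lemma coset_pr: "c \<in> carrier (Isom_hyp e) \<Longrightarrow> coset (pr c) = c"
  by (metis Isom_obtain pr_coset)

lemma coset_closed: "g \<in> carrier (O1inf e) \<Longrightarrow> coset g \<in> carrier (Isom_hyp e)"
  by (simp add: carrier_Isom)

lemma pr_mult:
  assumes "c \<in> carrier (Isom_hyp e)" "d \<in> carrier (Isom_hyp e)"
  shows "pr (c \<otimes>\<^bsub>Isom_hyp e\<^esub> d) = pr c \<circ> pr d"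
  using assms by (elim Isom_obtain) (simp add: Isom_mult O_plus_O1inf pr_coset O_plus_comp)

lemma pr_one: "pr \<one>\<^bsub>Isom_hyp e\<^esub> = id"
  by (simp add: Isom_one pr_coset O_plus_id)

lemma pr_inv:
  assumes "c \<in> carrier (Isom_hyp e)"
  shows "pr (inv\<^bsub>Isom_hyp e\<^esub> c) = gi (pr c)"
proof -
  interpret group "Isom_hyp e" by (rule group_Isom)
  have "pr (inv\<^bsub>Isom_hyp e\<^esub> c) \<circ> pr c = id"
    using pr_mult[of "inv\<^bsub>Isom_hyp e\<^esub> c" c] assms by (simp add: pr_one)
  moreover have "surj (pr c)"
    using pr_O1inf[OF assms] by (simp add: O1inf_iff bij_is_surj)
  ultimately show ?thesis
    using O1inf_gi(1)[OF pr_O1inf[OF assms]] by (simp add: fun_eq_iff) metis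
qed

section \<open>Lines and points\<close>

lemma Q_scale: "Q e (a *\<^sub>R x) = a\<^sup>2 * Q e x"
  by (simp add: Q_bil bil_simps power2_eq_square)

lemma hyp_bar_iff: "L \<in> hyp_bar e \<longleftrightarrow> (\<exists>v. Q e v \<ge> 0 \<and> v \<bullet> e 0 > 0 \<and> L = span {v})"
proof
  assume L: "L \<in> hyp_bar e"
  then obtain v where v: "v \<noteq> 0" "L = span {v}"
    by (auto simp: hyp_bar_def positive_lines_def isotropic_lines_def lines_def)
  have "v \<in> L" using v by (simp add: span_base)
  have "L \<in> positive_lines e \<or> L \<in> isotropic_lines e"
    using L by (simp add: hyp_bar_def)
  then have "Q e v \<ge> 0"
  proof
    assume "L \<in> positive_lines e"
    then have "\<forall>x\<in>L - {0}. Q e x > 0" by (simp add: positive_lines_def)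
    then show ?thesis using \<open>v \<in> L\<close> v(1) by (simp add: less_imp_le)
  next
    assume "L \<in> isotropic_lines e"
    then show ?thesis using \<open>v \<in> L\<close> by (simp add: isotropic_lines_def)
  qed
  have span_v: "span {- v} = span {v}"
    using span_image_scale[of "{v}" "\<lambda>_. -1"] by simp
  have Q_v: "Q e (- v) = Q e v"
    by (simp add: Q_bil bil_simps)
  have "v \<bullet> e 0 > 0 \<or> - v \<bullet> e 0 > 0"
    using forward_nonzero[OF \<open>Q e v \<ge> 0\<close> v(1)] by auto
  then show "\<exists>v. Q e v \<ge> 0 \<and> v \<bullet> e 0 > 0 \<and> L = span {v}"
  proof
    assume "v \<bullet> e 0 > 0"
    with \<open>Q e v \<ge> 0\<close> v(2) show ?thesis by (intro exI[of _ v]) simp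
  next
    assume "- v \<bullet> e 0 > 0"
    with \<open>Q e v \<ge> 0\<close> v(2) show ?thesis by (intro exI[of _ "- v"]) (simp add: Q_v span_v)
  qed
next
  assume "\<exists>v. Q e v \<ge> 0 \<and> v \<bullet> e 0 > 0 \<and> L = span {v}"
  then obtain v where v: "Q e v \<ge> 0" "v \<bullet> e 0 > 0" "L = span {v}" by blast
  have "v \<noteq> 0" using v(2) by auto
  then have "L \<in> lines" unfolding lines_def v(3) by blast
  moreover have "Q e v = 0 \<Longrightarrow> L \<in> isotropic_lines e" "Q e v > 0 \<Longrightarrow> L \<in> positive_lines e"
    using \<open>L \<in> lines\<close>
    unfolding isotropic_lines_def positive_lines_def v(3) span_singleton by (auto simp: Q_scale zero_less_mult_iff)
  ultimately show "L \<in> hyp_bar e"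
    using v(1) unfolding hyp_bar_def by (cases "Q e v = 0") auto
qed

lemma hyp_barI: "Q e v \<ge> 0 \<Longrightarrow> v \<bullet> e 0 > 0 \<Longrightarrow> span {v} \<in> hyp_bar e"
  by (auto simp: hyp_bar_iff)

lemma line_act_span:
  assumes c: "c \<in> carrier (Isom_hyp e)" and v: "span {v} \<in> hyp_bar e"
  shows "line_act e c (span {v}) = span {pr c v}"
proof -
  define g where "g = pr c"
  have lin: "linear g" using c pr_O1inf O1inf_linear by (simp add: g_def)
  have "span {v} = uminus ` span {v}"
    by (auto simp: image_iff span_neg) (metis minus_minus span_neg)
  then have "(uminus \<circ> g) ` span {v} = g ` span {v}"
    using image_comp[of uminus g "span {v}"] image_comp[of g uminus "span {v}"] linear_neg[OF lin]
    by (simp add: comp_def)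
  then have "(\<Union>h\<in>coset g. h ` span {v}) = g ` span {v}"
    by (auto simp: coset_def)
  also have "\<dots> = span {g v}"
    using linear_span_image[OF lin, of "{v}"] by simp
  finally show ?thesis
    using v coset_pr[OF c] by (simp add: line_act_def g_def)
qed

lemma hyp_mem: "x \<in> hyp e \<longleftrightarrow> Q e x = 1 \<and> x \<bullet> e 0 > 0"
  by (simp add: hyp_def)

lemma pr_hyp: "c \<in> carrier (Isom_hyp e) \<Longrightarrow> x \<in> hyp e \<Longrightarrow> pr c x \<in> hyp e"
  using O_plus_forward[OF pr_O_plus] pr_O1inf[of c] by (simp add: hyp_mem O1inf_iff)

lemma span_eq_forward:
  assumes "span {x} = span {y}" "x \<bullet> e 0 > 0" "y \<bullet> e 0 > 0"
  obtains t where "t > 0" "x = t *\<^sub>R y"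
proof -
  have "x \<in> span {y}" using assms(1) by (metis singletonI span_base)
  then obtain t where t: "x = t *\<^sub>R y" by (auto simp: span_singleton)
  then have "t * (y \<bullet> e 0) > 0" using assms(2) by simp
  then have "t > 0" using assms(3) zero_less_mult_pos2 by blast
  then show ?thesis using t that by blast
qed

lemma hyp_act_eq:
  assumes c: "c \<in> carrier (Isom_hyp e)" and x: "x \<in> hyp e"
  shows "hyp_act e c x = pr c x"
proof -
  have "line_act e c (span {x}) = span {pr c x}"
    using c x by (intro line_act_span) (auto simp: hyp_mem intro: hyp_barI)
  \<comment> \<open>A line meets the hyperboloid at most once, which makes the definite description
    in \<open>hyp_act\<close> meaningful.\<close>
  moreover have "y = z" if yz: "span {y} = span {z}" "y \<in> hyp e" "z \<in> hyp e" for y z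
  proof -
    obtain t where t: "t > 0" "y = t *\<^sub>R z"
      using yz span_eq_forward by (metis hyp_mem)
    then have "t\<^sup>2 = 1"
      using yz Q_scale[of t z] by (simp add: hyp_mem)
    then have "t = 1"
      using t(1) by (simp add: power2_eq_1_iff)
    then show ?thesis using t by simp
  qed
  ultimately show ?thesis
    unfolding hyp_act_def using pr_hyp[OF assms] by (intro the_equality) auto
qed

section \<open>The disc model of the space of lines\<close>

abbreviation pt :: "'a set \<Rightarrow> 'a" where
  "pt \<equiv> inv_into (disc_bar e) (disc_line e)"

lemma Q_e0_add:
  assumes "x \<bullet> e 0 = 0"
  shows "Q e (e 0 + x) = 1 - (norm x)\<^sup>2"
  using assms unfolding Q_eq power2_norm_eq_inner
  by (simp add: inner_add_left inner_add_right e_inner inner_commute[of "e 0" x])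

lemma disc_vector:
  assumes "x \<in> disc_bar e"
  shows "Q e (e 0 + x) = 1 - (norm x)\<^sup>2" "(e 0 + x) \<bullet> e 0 = 1" "Q e (e 0 + x) \<ge> 0"
proof -
  show *: "Q e (e 0 + x) = 1 - (norm x)\<^sup>2" and "(e 0 + x) \<bullet> e 0 = 1"
    using assms by (auto simp: disc_bar_def Q_e0_add e_inner inner_add_left)
  show "Q e (e 0 + x) \<ge> 0"
    using assms * by (simp add: disc_bar_def power_le_one)
qed

lemma disc_line_inj: "inj_on (disc_line e) (disc_bar e)"
proof (rule inj_onI)
  fix x y assume xy: "x \<in> disc_bar e" "y \<in> disc_bar e" "disc_line e x = disc_line e y"
  then obtain t where t: "e 0 + x = t *\<^sub>R (e 0 + y)"
    using span_eq_forward[of "e 0 + x" "e 0 + y"] disc_vector(2)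
    unfolding disc_line_def by (metis zero_less_one)
  then have "(e 0 + x) \<bullet> e 0 = t * ((e 0 + y) \<bullet> e 0)" by simp
  then have "t = 1" using xy by (simp add: disc_vector)
  then show "x = y" using t by simp
qed

lemma scaled_mem_disc:
  assumes "Q e v \<ge> 0" "v \<bullet> e 0 > 0"
  shows "(1 / (v \<bullet> e 0)) *\<^sub>R v - e 0 \<in> disc_bar e"
    and "disc_line e ((1 / (v \<bullet> e 0)) *\<^sub>R v - e 0) = span {v}"
proof -
  define x where "x = (1 / (v \<bullet> e 0)) *\<^sub>R v - e 0"
  have x0: "x \<bullet> e 0 = 0"
    using assms by (simp add: x_def inner_diff_left e_inner)
  have ex: "e 0 + x = (1 / (v \<bullet> e 0)) *\<^sub>R v" by (simp add: x_def)
  then have "Q e (e 0 + x) \<ge> 0" using assms by (simp add: Q_scale)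
  moreover have "Q e (e 0 + x) = 1 - (norm x)\<^sup>2"
    using x0 by (rule Q_e0_add)
  ultimately have "(norm x)\<^sup>2 \<le> 1\<^sup>2" by simp
  then have "norm x \<le> 1"
    by (rule power2_le_imp_le) simp
  then show "(1 / (v \<bullet> e 0)) *\<^sub>R v - e 0 \<in> disc_bar e"
    using x0 by (simp add: disc_bar_def x_def)
  have "span {(1 / (v \<bullet> e 0)) *\<^sub>R v} = span {v}"
    using assms(2) span_image_scale[of "{v}" "\<lambda>_. 1 / (v \<bullet> e 0)"] by simp
  then show "disc_line e ((1 / (v \<bullet> e 0)) *\<^sub>R v - e 0) = span {v}"
    by (simp add: disc_line_def)
qed

lemma pt_span: "pt (span {v}) = (1 / (v \<bullet> e 0)) *\<^sub>R v - e 0"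
  if "Q e v \<ge> 0" "v \<bullet> e 0 > 0"
  using inv_into_f_f[OF disc_line_inj scaled_mem_disc(1)[OF that]] scaled_mem_disc(2)[OF that]
  by simp

lemma disc_line_mem: "x \<in> disc_bar e \<Longrightarrow> disc_line e x \<in> hyp_bar e"
  using disc_vector[of x] by (auto simp: disc_line_def intro!: hyp_barI)

lemma pt_disc_line: "x \<in> disc_bar e \<Longrightarrow> pt (disc_line e x) = x"
  by (rule inv_into_f_f[OF disc_line_inj])

lemma pt_mem: "L \<in> hyp_bar e \<Longrightarrow> pt L \<in> disc_bar e"
  and disc_line_pt: "L \<in> hyp_bar e \<Longrightarrow> disc_line e (pt L) = L"
  by (auto simp: hyp_bar_iff pt_span scaled_mem_disc)

lemma pt_inj: "L \<in> hyp_bar e \<Longrightarrow> M \<in> hyp_bar e \<Longrightarrow> pt L = pt M \<Longrightarrow> L = M"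
  by (metis disc_line_pt)

section \<open>Reflections and transitivity\<close>

definition refl :: "'a \<Rightarrow> 'a \<Rightarrow> 'a" where
  "refl w x = x - (2 * bil e x w / Q e w) *\<^sub>R w"

lemma refl_O1inf:
  assumes "Q e w \<noteq> 0"
  shows "refl w \<in> carrier (O1inf e)"
proof -
  have w: "bil e w w \<noteq> 0" using assms by (simp add: Q_bil)
  have inv: "refl w (refl w x) = x" for x
    using w by (simp add: refl_def bil_simps Q_bil field_simps scaleR_add_left[symmetric])
  have "bij (refl w)"
    by (rule o_bij[of "refl w"]) (auto simp: inv fun_eq_iff)
  moreover have "bounded_linear (refl w)"
    unfolding refl_def bil_eq_inner divide_inverse
    by (intro bounded_linear_sub bounded_linear_ident
        bounded_linear_compose[OF bounded_linear_scaleR_left]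
        bounded_linear_mult_const bounded_linear_const_mult
        bounded_linear_compose[OF bounded_linear_inner_left] bounded_linear_J)
  moreover have "Q e (refl w x) = Q e x" for x
    using w by (simp add: Q_bil refl_def bil_simps bil_commute[of w x] field_simps)
  ultimately show ?thesis
    by (simp add: O1inf_iff)
qed

lemma refl_swap:
  assumes "Q e u = Q e v" "Q e (u - v) \<noteq> 0"
  shows "refl (u - v) u = v"
proof -
  have "2 * bil e u (u - v) = Q e (u - v)"
    using assms(1) by (simp add: Q_bil bil_simps bil_commute[of v u])
  then show ?thesis
    using assms(2) by (simp add: refl_def)
qed

text \<open>A single forward vector decides: if the forward representative were the negative of
  \<open>g\<close>, it would also keep \<open>v\<close> forward, and so \<open>g v\<close> would
  point backward.\<close>

lemma O_plusI:
  assumes g: "g \<in> carrier (O1inf e)" and v: "Q e v \<ge> 0" "v \<bullet> e 0 > 0" "g v \<bullet> e 0 > 0"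
  shows "g \<in> O_plus"
  using g
proof (cases rule: O_plus_cases)
  case 2
  then show ?thesis
    using O_plus_forward[OF 2(1) v(1,2)] v(3) by simp
qed

lemma exists_O_plus:
  assumes "Q e u = Q e v" "Q e u \<ge> 0" "Q e (u - v) \<noteq> 0" "u \<bullet> e 0 > 0" "v \<bullet> e 0 > 0"
  obtains g where "g \<in> O_plus" "g u = v"
  using assms refl_swap[of u v] O_plusI[OF refl_O1inf[of "u - v"], of u] that by simp

text \<open>On the hyperboloid the norm distance to \<open>e 0\<close> is a function of one
  coordinate. This is why weak convergence there is norm convergence.\<close>

lemma dist_e0: "(norm (x - e 0))\<^sup>2 = 2 * (x \<bullet> e 0) * (x \<bullet> e 0 - 1)" if "x \<in> hyp e"
proof -
  have "(norm (x - e 0))\<^sup>2 = (norm x)\<^sup>2 - 2 * (x \<bullet> e 0) + 1"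
    unfolding power2_norm_eq_inner
    by (simp add: inner_diff_left inner_diff_right e_inner inner_commute[of "e 0"])
  moreover have "(norm x)\<^sup>2 = 2 * (x \<bullet> e 0)\<^sup>2 - 1"
    using that norm_eq_Q[of x] by (simp add: hyp_mem)
  ultimately show ?thesis
    by (simp add: power2_eq_square algebra_simps)
qed

lemma e0_hyp: "e 0 \<in> hyp e"
  by (simp add: hyp_mem Q_e0 e_inner)

text \<open>Moving to the base point always works with one reflection, because Q (u - e_0) = 2 - 2
  u_0 vanishes only at u = e_0. Statements about pairs of points are reduced to this case.\<close>

lemma hyp_to_e0:
  assumes "u \<in> hyp e"
  obtains g where "g \<in> O_plus" "g u = e 0"
proof (cases "u \<bullet> e 0 = 1")
  case True
  then have "u = e 0" using dist_e0[OF assms] by simp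
  then show ?thesis using O_plus_id that by (metis id_apply)
next
  case False
  have "Q e (u - e 0) = 2 - 2 * (u \<bullet> e 0)"
    using assms Q_e0 bil_e0[of u] by (simp add: Q_bil bil_simps hyp_mem bil_commute[of "e 0" u])
  then have "Q e (u - e 0) \<noteq> 0" using False by simp
  moreover have "Q e u = 1" "u \<bullet> e 0 > 0" using assms by (simp_all add: hyp_mem)
  moreover have "e 0 \<bullet> e 0 > 0" by (simp add: e_inner)
  ultimately show ?thesis
    using exists_O_plus[of u "e 0"] Q_e0 that by (metis zero_le_one)
qed

section \<open>The hyperbolic metric\<close>

lemma O_plus_hyp: "g \<in> O_plus \<Longrightarrow> x \<in> hyp e \<Longrightarrow> g x \<in> hyp e"
  using O_plus_forward[of g x] O_plus_O1inf[of g] by (simp add: hyp_mem O1inf_iff)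

lemma hyp_e0_ge_1: "x \<bullet> e 0 \<ge> 1" if "x \<in> hyp e"
proof -
  have "2 * (x \<bullet> e 0) * (x \<bullet> e 0 - 1) \<ge> 0"
    using dist_e0[OF that] by (metis zero_le_power2)
  then show ?thesis using that by (simp add: hyp_mem zero_le_mult_iff)
qed

lemma bil_hyp_ge_1: "bil e x y \<ge> 1" if xy: "x \<in> hyp e" "y \<in> hyp e"
proof -
  obtain g where g: "g \<in> O_plus" "g y = e 0" using hyp_to_e0[OF xy(2)] .
  have "bil e x y = g x \<bullet> e 0"
    using O1inf_bil[OF O_plus_O1inf[OF g(1)], of x y] g(2) by (simp add: bil_e0)
  then show ?thesis
    using hyp_e0_ge_1[OF O_plus_hyp[OF g(1) xy(1)]] by simp
qed

lemma bil_hyp_eq_1: "x = y" if xy: "x \<in> hyp e" "y \<in> hyp e" and b: "bil e x y = 1"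
proof -
  obtain g where g: "g \<in> O_plus" "g y = e 0" using hyp_to_e0[OF xy(2)] .
  have "g x \<bullet> e 0 = 1"
    using O1inf_bil[OF O_plus_O1inf[OF g(1)], of x y] g(2) b by (simp add: bil_e0)
  then have "g x = g y"
    using dist_e0[OF O_plus_hyp[OF g(1) xy(1)]] g(2) by simp
  then show ?thesis
    using O1inf_gi(2)[OF O_plus_O1inf[OF g(1)]] by metis
qed

text \<open>On the hyperboloid the square roots in \<open>bil_bounds\<close> are the sinh of the
  distances to \<open>e 0\<close>, so the upper bound there reads cosh (a + b). Transitivity extends
  this to an arbitrary middle vertex.\<close>

lemma hyp_dist_triangle_e0:
  assumes "x \<in> hyp e" "z \<in> hyp e"
  shows "arcosh (bil e x z) \<le> arcosh (x \<bullet> e 0) + arcosh (z \<bullet> e 0)"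
proof -
  let ?a = "arcosh (x \<bullet> e 0)" and ?b = "arcosh (z \<bullet> e 0)"
  note ge = hyp_e0_ge_1[OF assms(1)] hyp_e0_ge_1[OF assms(2)]
  have "bil e x z \<le> cosh (?a + ?b)"
    using bil_bounds(2)[of x z] ge assms
    by (simp add: cosh_add sinh_arcosh_real hyp_mem)
  moreover have "?a + ?b \<ge> 0" using ge by simp
  ultimately have "arcosh (bil e x z) \<le> arcosh (cosh (?a + ?b))"
    using bil_hyp_ge_1[OF assms] by (metis arcosh_less_iff_real cosh_real_ge_1 not_le)
  then show ?thesis
    using \<open>?a + ?b \<ge> 0\<close> by (simp add: arcosh_cosh_real)
qed

lemma Metric_space_hyp: "Metric_space (hyp e) (hyp_dist e)"
proof
  show "0 \<le> hyp_dist e x y" for x y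
    by (simp add: hyp_dist_def bil_hyp_ge_1)
  show "hyp_dist e x y = hyp_dist e y x" for x y
    by (simp add: hyp_dist_def bil_commute)
  show "hyp_dist e x y = 0 \<longleftrightarrow> x = y" if "x \<in> hyp e" "y \<in> hyp e" for x y
    using that bil_hyp_ge_1[of x y] bil_hyp_eq_1[of x y]
    by (auto simp: hyp_dist_def) (simp add: hyp_mem Q_bil)
  show "hyp_dist e x z \<le> hyp_dist e x y + hyp_dist e y z"
    if xyz: "x \<in> hyp e" "y \<in> hyp e" "z \<in> hyp e" for x y z
  proof -
    obtain g where g: "g \<in> O_plus" "g y = e 0" using hyp_to_e0[OF xyz(2)] .
    note inv = O1inf_bil[OF O_plus_O1inf[OF g(1)]]
    have "bil e x y = g x \<bullet> e 0" "bil e y z = g z \<bullet> e 0"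
      using inv[of x y] inv[of z y] g(2) bil_commute[of y z] by (simp_all add: bil_e0)
    then show ?thesis
      using that hyp_dist_triangle_e0[of "g x" "g z"] O_plus_hyp[OF g(1)] inv[of x z]
      by (simp add: hyp_dist_def)
  qed
qed

abbreviation hyp_topology :: "'a topology" where
  "hyp_topology \<equiv> Metric_space.mtopology (hyp e) (hyp_dist e)"

text \<open>An isometry takes \<open>l\<close> to \<open>e 0\<close>, where \<open>dist_e0\<close>
  expresses the norm distance through the one number assumed to converge. Its inverse is bounded and
  brings the convergence back.\<close>

lemma tendsto_hyp:
  assumes f: "\<forall>\<^sub>F t in F. f t \<in> hyp e" and l: "l \<in> hyp e" and lim: "((\<lambda>t. bil e (f t) l) \<longlongrightarrow> 1) F"
  shows "(f \<longlongrightarrow> l) F"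
proof -
  obtain g where g: "g \<in> O_plus" "g l = e 0" using hyp_to_e0[OF l] .
  note O = O_plus_O1inf[OF g(1)]
  have b: "bil e x l = g x \<bullet> e 0" for x
    using O1inf_bil[OF O, of x l] g(2) by (simp add: bil_e0)
  have "((\<lambda>t. 2 * (g (f t) \<bullet> e 0) * (g (f t) \<bullet> e 0 - 1)) \<longlongrightarrow> 2 * 1 * (1 - 1)) F"
    using lim by (intro tendsto_intros) (simp_all add: b)
  moreover have "\<forall>\<^sub>F t in F. 2 * (g (f t) \<bullet> e 0) * (g (f t) \<bullet> e 0 - 1) = (norm (g (f t) - e 0))\<^sup>2"
    using f by eventually_elim (simp add: dist_e0 O_plus_hyp[OF g(1)])
  ultimately have "((\<lambda>t. (norm (g (f t) - e 0))\<^sup>2) \<longlongrightarrow> 0) F"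
    by (simp add: Lim_transform_eventually)
  then have "((\<lambda>t. sqrt ((norm (g (f t) - e 0))\<^sup>2)) \<longlongrightarrow> sqrt 0) F"
    by (intro tendsto_intros)
  then have "((\<lambda>t. g (f t)) \<longlongrightarrow> e 0) F"
    by (simp only: real_sqrt_abs abs_norm_cancel real_sqrt_zero tendsto_norm_zero_iff LIM_zero_iff)
  then have "((\<lambda>t. gi g (g (f t))) \<longlongrightarrow> gi g (e 0)) F"
    using O1inf_gi_closed[OF O] by (intro bounded_linear.tendsto[of "gi g"]) (simp_all add: O1inf_iff)
  moreover have "gi g (e 0) = l"
    using O1inf_gi(2)[OF O, of l] g(2) by simp
  ultimately show ?thesis
    by (simp only: O1inf_gi(2)[OF O])
qed

text \<open>The hyperbolic metric and the norm induce the same topology: as cosh of the distance is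
  the form, both convergences amount to bil (f t) l tending to 1.\<close>

lemma limitin_hyp:
  assumes f: "\<forall>\<^sub>F t in F. f t \<in> hyp e" and l: "l \<in> hyp e"
  shows "limitin hyp_topology f l F \<longleftrightarrow> (f \<longlongrightarrow> l) F"
proof
  assume L: "limitin hyp_topology f l F"
  have d0: "((\<lambda>t. hyp_dist e (f t) l) \<longlongrightarrow> 0) F"
    unfolding tendsto_iff
  proof (intro allI impI)
    fix \<epsilon> :: real assume "\<epsilon> > 0"
    then have "\<forall>\<^sub>F t in F. f t \<in> hyp e \<and> hyp_dist e (f t) l < \<epsilon>"
      using L unfolding Metric_space.limitin_metric[OF Metric_space_hyp] by blast
    then show "\<forall>\<^sub>F t in F. dist (hyp_dist e (f t) l) 0 < \<epsilon>"
      by eventually_elim (simp add: Metric_space.nonneg[OF Metric_space_hyp])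
  qed
  have "((\<lambda>t. cosh (hyp_dist e (f t) l)) \<longlongrightarrow> cosh 0) F"
    by (intro tendsto_intros d0)
  moreover have "\<forall>\<^sub>F t in F. cosh (hyp_dist e (f t) l) = bil e (f t) l"
    using f by eventually_elim (simp add: hyp_dist_def l bil_hyp_ge_1)
  ultimately have "((\<lambda>t. bil e (f t) l) \<longlongrightarrow> 1) F"
    by (simp add: Lim_transform_eventually)
  then show "(f \<longlongrightarrow> l) F"
    by (rule tendsto_hyp[OF f l])
next
  assume L: "(f \<longlongrightarrow> l) F"
  have "((\<lambda>t. bil e (f t) l) \<longlongrightarrow> bil e l l) F"
    unfolding bil_eq_inner by (intro tendsto_intros bounded_linear.tendsto[OF bounded_linear_J] L)
  then have lim: "((\<lambda>t. bil e (f t) l) \<longlongrightarrow> 1) F"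
    using l by (simp add: hyp_mem Q_bil)
  show "limitin hyp_topology f l F"
    unfolding Metric_space.limitin_metric[OF Metric_space_hyp]
  proof (intro conjI l allI impI)
    fix \<epsilon> :: real assume "\<epsilon> > 0"
    then have "cosh \<epsilon> > 1" using cosh_real_strict_mono[of 0 \<epsilon>] by simp
    then have "\<forall>\<^sub>F t in F. bil e (f t) l < cosh \<epsilon>"
      using lim by (rule order_tendstoD(2)[rotated])
    with f show "\<forall>\<^sub>F t in F. f t \<in> hyp e \<and> hyp_dist e (f t) l < \<epsilon>"
    proof eventually_elim
      case (elim t)
      have "arcosh (bil e (f t) l) < arcosh (cosh \<epsilon>)"
        using elim bil_hyp_ge_1[OF elim(1) l] by (intro arcosh_real_strict_mono) auto
      then show ?case
        using elim l \<open>\<epsilon> > 0\<close> by (simp add: hyp_dist_def arcosh_cosh_real)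
    qed
  qed
qed

lemma continuous_map_hyp:
  "continuous_map Y hyp_topology f \<longleftrightarrow> f \<in> topspace Y \<rightarrow> hyp e \<and> continuous_map Y euclidean f"
proof -
  have "limitin hyp_topology f (f t) (atin Y t) \<longleftrightarrow> (f \<longlongrightarrow> f t) (atin Y t)"
    if "f \<in> topspace Y \<rightarrow> hyp e" "t \<in> topspace Y" for t
    using that by (intro limitin_hyp) (auto simp: eventually_atin)
  moreover have "f \<in> topspace Y \<rightarrow> hyp e" if "continuous_map Y hyp_topology f"
    using that continuous_map_funspace
    by (metis Metric_space.topspace_mtopology[OF Metric_space_hyp])
  ultimately show ?thesis
    by (auto simp: continuous_map_atin)
qed

section \<open>The topology of the isometry group\<close>

text \<open>With a = (g e_0)_0, also the \<open>e 0\<close>-coordinate of \<open>gi g (e 0)\<close>,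
  the square of its norm is 2 a^2 - 1. The factor in \<open>norm_O1inf_le\<close> becomes 2 (2 a^2 -
  1) + 1 = 4 a^2 - 1, at most (2 a)^2. The bound is one matrix coefficient, hence stable under
  limits.\<close>

lemma norm_O_plus_le: "norm (g x) \<le> 2 * (g (e 0) \<bullet> e 0) * norm x" if g: "g \<in> O_plus"
proof -
  note O = O_plus_O1inf[OF g]
  let ?a = "g (e 0) \<bullet> e 0"
  have "gi g (e 0) \<bullet> e 0 = ?a"
    using bil_gi[OF O, of "e 0" "e 0"] by (simp add: bil_e0 bil_commute[of "e 0"])
  moreover have "Q e (gi g (e 0)) = 1"
    using O1inf_gi_closed[OF O] by (simp add: O1inf_iff Q_e0)
  ultimately have n: "(norm (gi g (e 0)))\<^sup>2 = 2 * ?a\<^sup>2 - 1"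
    by (simp add: norm_eq_Q)
  have "(norm (g x))\<^sup>2 \<le> (4 * ?a\<^sup>2 - 1) * (norm x)\<^sup>2"
    using norm_O1inf_le[OF O, of x] by (simp add: n algebra_simps)
  also have "\<dots> \<le> (4 * ?a\<^sup>2) * (norm x)\<^sup>2"
    by (intro mult_right_mono) auto
  also have "\<dots> = (2 * ?a * norm x)\<^sup>2"
    by (simp add: power_mult_distrib)
  finally show ?thesis
    by (rule power2_le_imp_le) (use g in \<open>simp add: O_plus_def\<close>)
qed

text \<open>The other basis vectors have Q = -1; adding sqrt 2 times \<open>e 0\<close> gives Q = 2
  - 1. Subtracting a multiple of \<open>e 0\<close> recovers them, so values on the hyperboloid
  determine a linear map on the whole basis.\<close>

lemma shifted_basis_hyp: "sqrt 2 *\<^sub>R e 0 + e i \<in> hyp e" if "i \<noteq> 0"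
  using that by (simp add: hyp_mem Q_bil bil_simps bil_e0 bil_commute[of "e 0" "e i"])
    (simp add: bil_eq e_inner inner_add_left)

lemma hyp_total: "x \<in> closure (span (hyp e))"
proof -
  have "e i \<in> span (hyp e)" for i
  proof (cases "i = 0")
    case True
    then show ?thesis by (simp add: e0_hyp span_base)
  next
    case False
    then have "sqrt 2 *\<^sub>R e 0 + e i \<in> hyp e"
      by (rule shifted_basis_hyp)
    then have "(sqrt 2 *\<^sub>R e 0 + e i) - sqrt 2 *\<^sub>R e 0 \<in> span (hyp e)"
      using e0_hyp by (intro span_diff span_scale span_base)
    then show ?thesis by simp
  qed
  then have "span (range e) \<subseteq> span (hyp e)"
    by (simp add: image_subset_iff span_minimal)
  then show ?thesis
    using e_total closure_mono by blast
qed

text \<open>From matrix coefficients to strong convergence. The coefficient (0,0) bounds the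
  operators near the limit, so the coefficients extend to all pairs of vectors, in the second
  argument and then in the first. On the hyperboloid weak convergence is norm convergence, and the
  hyperboloid is total.\<close>

lemma strong_limit:
  assumes G: "\<forall>\<^sub>F t in F. G t \<in> O_plus" and g: "g \<in> O_plus"
    and coeff: "\<And>i j. ((\<lambda>t. G t (e i) \<bullet> e j) \<longlongrightarrow> g (e i) \<bullet> e j) F"
  shows "((\<lambda>t. G t x) \<longlongrightarrow> g x) F"
proof -
  \<comment> \<open>The summand 1 is slack: eventually the (0,0) coefficient of \<open>G t\<close>
    is below that of \<open>g\<close> plus 1, and then \<open>norm_O_plus_le\<close> applies with
    one constant.\<close>
  define C where "C = 2 * (g (e 0) \<bullet> e 0 + 1)"
  have lin: "linear h" if "h \<in> O_plus" for h
    using that O_plus_O1inf O1inf_linear by blast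
  have bd: "norm (h x) \<le> C * norm x" if "h \<in> O_plus" "h (e 0) \<bullet> e 0 < g (e 0) \<bullet> e 0 + 1" for h x
    using norm_O_plus_le[OF that(1), of x] that(2)
    by (smt (verit) C_def mult_right_mono norm_ge_zero)
  have g_bd: "norm (g x) \<le> C * norm x" for x
    by (intro bd g) simp
  have "\<forall>\<^sub>F t in F. G t (e 0) \<bullet> e 0 < g (e 0) \<bullet> e 0 + 1"
    using coeff[of 0 0] by (rule order_tendstoD(2)) simp
  with G have ev: "\<forall>\<^sub>F t in F. linear (G t) \<and> (\<forall>x. norm (G t x) \<le> C * norm x)"
    by eventually_elim (auto simp: lin intro: bd)
  have inner_bd: "norm (a \<bullet> y) \<le> C * norm b * norm y" if "norm a \<le> C * norm b" for a b y :: 'a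
  proof -
    have "norm (a \<bullet> y) \<le> norm a * norm y"
      using Cauchy_Schwarz_ineq2[of a y] by simp
    also have "\<dots> \<le> C * norm b * norm y"
      using that by (intro mult_right_mono) auto
    finally show ?thesis .
  qed
  have weak_i: "((\<lambda>t. G t (e i) \<bullet> y) \<longlongrightarrow> g (e i) \<bullet> y) F" for i y
  proof (rule tendsto_closure_span[where S = "range e" and B = "C * norm (e i)" and
        f = "\<lambda>t y. G t (e i) \<bullet> y" and ?f0.0 = "\<lambda>y. g (e i) \<bullet> y"])
    show "\<forall>\<^sub>F t in F. linear ((\<bullet>) (G t (e i))) \<and>
        (\<forall>y. norm (G t (e i) \<bullet> y) \<le> C * norm (e i) * norm y)"
      using ev by eventually_elim
        (auto intro!: inner_bd linearI simp del: norm_e real_norm_def simp: inner_add_right)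
  qed (use coeff e_total g_bd in \<open>auto intro!: inner_bd linearI
      simp del: norm_e real_norm_def simp: inner_add_right\<close>)
  have weak: "((\<lambda>t. G t x \<bullet> y) \<longlongrightarrow> g x \<bullet> y) F" for x y
  proof (rule tendsto_closure_span[where S = "range e" and B = "C * norm y" and
        f = "\<lambda>t x. G t x \<bullet> y" and ?f0.0 = "\<lambda>x. g x \<bullet> y"])
    have ib: "norm (a \<bullet> y) \<le> C * norm y * norm b" if "norm a \<le> C * norm b" for a b :: 'a
      using inner_bd[OF that, of y] by (simp only: mult.assoc mult.commute[of "norm y"])
    show "\<forall>\<^sub>F t in F. linear (\<lambda>x. G t x \<bullet> y) \<and> (\<forall>x. norm (G t x \<bullet> y) \<le> C * norm y * norm x)"
      using ev by eventually_elim
        (auto intro!: ib linearI simp del: real_norm_def simp: inner_add_left linear_add linear_scale)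
    show "linear (\<lambda>x. g x \<bullet> y)"
      using lin[OF g] by (auto intro!: linearI simp: inner_add_left linear_add linear_scale)
    show "norm (g x \<bullet> y) \<le> C * norm y * norm x" for x
      by (intro ib g_bd)
  qed (use weak_i e_total in auto)
  show ?thesis
  proof (rule tendsto_closure_span[where S = "hyp e" and B = C and f = G and ?f0.0 = g])
    show "((\<lambda>t. G t s) \<longlongrightarrow> g s) F" if s: "s \<in> hyp e" for s
    proof (rule tendsto_hyp)
      show "\<forall>\<^sub>F t in F. G t s \<in> hyp e"
        using G by eventually_elim (simp add: O_plus_hyp s)
      have "((\<lambda>t. G t s \<bullet> J (g s)) \<longlongrightarrow> g s \<bullet> J (g s)) F" by (rule weak)
      moreover have "g s \<bullet> J (g s) = 1"
        using O_plus_hyp[OF g s] by (simp add: hyp_mem Q_bil bil_eq_inner J_inner)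
      ultimately show "((\<lambda>t. bil e (G t s) (g s)) \<longlongrightarrow> 1) F"
        by (simp add: bil_eq_inner J_inner)
    qed (use g s O_plus_hyp in auto)
  qed (use ev lin[OF g] g_bd hyp_total in auto)
qed

lemma gi_coeff: "gi g x \<bullet> y = J x \<bullet> g (J y)" if "g \<in> carrier (O1inf e)"
  using bil_gi[OF that, of "J y" x] by (metis J_J bil_eq_inner J_inner inner_commute)

lemma strong_limit_gi:
  assumes G: "\<forall>\<^sub>F t in F. G t \<in> O_plus" and g: "g \<in> O_plus"
    and coeff: "\<And>i j. ((\<lambda>t. G t (e i) \<bullet> e j) \<longlongrightarrow> g (e i) \<bullet> e j) F"
  shows "((\<lambda>t. gi (G t) x) \<longlongrightarrow> gi g x) F"
proof (rule strong_limit[where G = "\<lambda>t. gi (G t)" and g = "gi g"])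
  fix i j
  have "((\<lambda>t. J (e i) \<bullet> G t (J (e j))) \<longlongrightarrow> J (e i) \<bullet> g (J (e j))) F"
    by (intro tendsto_intros strong_limit[OF assms])
  moreover have "\<forall>\<^sub>F t in F. J (e i) \<bullet> G t (J (e j)) = gi (G t) (e i) \<bullet> e j"
    using G by eventually_elim (simp add: gi_coeff O_plus_O1inf)
  ultimately show "((\<lambda>t. gi (G t) (e i) \<bullet> e j) \<longlongrightarrow> gi g (e i) \<bullet> e j) F"
    by (simp add: gi_coeff O_plus_O1inf g Lim_transform_eventually)
qed (use G O_plus_gi[OF g] in \<open>auto elim!: eventually_mono simp: O_plus_gi\<close>)

abbreviation "IsoT \<equiv> Isom_topology e"
abbreviation "IsoG \<equiv> Isom_hyp e"

lemma topspace_IsoT [simp]: "topspace IsoT = carrier IsoG"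
  by (auto simp: Isom_topology_def topspace_pullback_topology hyp_act_eq pr_hyp
      Metric_space.topspace_mtopology[OF Metric_space_hyp])

lemma continuous_map_coeff_imp:
  assumes F: "F \<in> topspace Y \<rightarrow> carrier IsoG"
    and coeff: "\<And>i j. continuous_map Y euclideanreal (\<lambda>t. pr (F t) (e i) \<bullet> e j)"
  shows "continuous_map Y euclidean (\<lambda>t. pr (F t) x)"
    and "continuous_map Y euclidean (\<lambda>t. gi (pr (F t)) x)"
proof -
  have *: "\<forall>\<^sub>F u in atin Y t. pr (F u) \<in> O_plus" if "t \<in> topspace Y" for t
    using F that by (auto simp: eventually_atin intro!: pr_O_plus)
  have lim: "((\<lambda>t. pr (F t) (e i) \<bullet> e j) \<longlongrightarrow> pr (F t0) (e i) \<bullet> e j) (atin Y t0)"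
    if "t0 \<in> topspace Y" for i j t0
    using coeff[of i j] that by (simp add: continuous_map_euclidean_tendsto)
  show "continuous_map Y euclidean (\<lambda>t. pr (F t) x)"
    unfolding continuous_map_euclidean_tendsto
    using F by (intro ballI strong_limit[where G = "\<lambda>t. pr (F t)"] * lim pr_O_plus) auto
  show "continuous_map Y euclidean (\<lambda>t. gi (pr (F t)) x)"
    unfolding continuous_map_euclidean_tendsto
    using F by (intro ballI strong_limit_gi[where G = "\<lambda>t. pr (F t)"] * lim pr_O_plus) auto
qed

lemma continuous_map_IsoT_coeff: "continuous_map IsoT euclideanreal (\<lambda>c. pr c (e i) \<bullet> e j)"
proof -
  have hyp: "continuous_map IsoT euclidean (\<lambda>c. pr c x)" if x: "x \<in> hyp e" for x
  proof -
    have "continuous_map (product_topology (\<lambda>_. hyp_topology) (hyp e)) hyp_topology (\<lambda>f. f x)"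
      using x by (rule continuous_map_product_projection)
    from continuous_map_pullback[OF this]
    have "continuous_map IsoT hyp_topology ((\<lambda>f. f x) \<circ> (\<lambda>c. \<lambda>x\<in>hyp e. hyp_act e c x))"
      unfolding Isom_topology_def .
    then have "continuous_map IsoT euclidean ((\<lambda>f. f x) \<circ> (\<lambda>c. \<lambda>x\<in>hyp e. hyp_act e c x))"
      by (simp add: continuous_map_hyp)
    then show ?thesis
      by (rule continuous_map_eq) (use x in \<open>simp add: hyp_act_eq\<close>)
  qed
  have "continuous_map IsoT euclidean (\<lambda>c. pr c (e i))"
  proof (cases "i = 0")
    case True
    then show ?thesis using hyp e0_hyp by simp
  next
    case False
    then have "sqrt 2 *\<^sub>R e 0 + e i \<in> hyp e"
      by (rule shifted_basis_hyp)
    then have "continuous_map IsoT euclidean (\<lambda>c. pr c (sqrt 2 *\<^sub>R e 0 + e i) - sqrt 2 *\<^sub>R pr c (e 0))"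
      using hyp e0_hyp unfolding continuous_map_euclidean_tendsto by (auto intro!: tendsto_intros)
    then show ?thesis
      by (rule continuous_map_eq)
        (simp add: linear_add linear_scale O1inf_linear pr_O1inf)
  qed
  then show ?thesis
    by (intro continuous_map_inner) auto
qed

text \<open>The pointwise topology is thus the initial topology of the matrix coefficients;
  continuity into the group is checked in this form below.\<close>

lemma continuous_map_IsoT:
  "continuous_map Y IsoT F \<longleftrightarrow> F \<in> topspace Y \<rightarrow> carrier IsoG \<and>
    (\<forall>i j. continuous_map Y euclideanreal (\<lambda>t. pr (F t) (e i) \<bullet> e j))"
proof safe
  fix i j assume F: "continuous_map Y IsoT F"
  show "F t \<in> carrier IsoG" if "t \<in> topspace Y" for t
    using continuous_map_funspace[OF F] that by auto
  show "continuous_map Y euclideanreal (\<lambda>t. pr (F t) (e i) \<bullet> e j)"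
    using continuous_map_compose[OF F continuous_map_IsoT_coeff] by (simp add: comp_def)
next
  assume F: "F \<in> topspace Y \<rightarrow> carrier IsoG"
    and "\<forall>i j. continuous_map Y euclideanreal (\<lambda>t. pr (F t) (e i) \<bullet> e j)"
  then have cont: "continuous_map Y euclidean (\<lambda>t. pr (F t) x)" for x
    by (intro continuous_map_coeff_imp) auto
  show "continuous_map Y IsoT F"
    unfolding Isom_topology_def
  proof (rule continuous_map_pullback')
    show "continuous_map Y (product_topology (\<lambda>_. hyp_topology) (hyp e))
        ((\<lambda>c. \<lambda>x\<in>hyp e. hyp_act e c x) \<circ> F)"
      unfolding continuous_map_componentwise
    proof (intro conjI ballI)
      fix x assume x: "x \<in> hyp e"
      have "continuous_map Y hyp_topology (\<lambda>t. pr (F t) x)"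
        using F x cont[of x] by (auto simp: continuous_map_hyp pr_hyp Pi_iff)
      then show "continuous_map Y hyp_topology (\<lambda>t. ((\<lambda>c. \<lambda>x\<in>hyp e. hyp_act e c x) \<circ> F) t x)"
        by (rule continuous_map_eq) (use F x in \<open>auto simp: hyp_act_eq Pi_iff\<close>)
    qed auto
  qed (use F in auto)
qed

lemma continuous_map_pr:
  assumes "continuous_map Y IsoT F"
  shows "continuous_map Y euclidean (\<lambda>t. pr (F t) x)"
    and "continuous_map Y euclidean (\<lambda>t. gi (pr (F t)) x)"
  using assms continuous_map_coeff_imp[of F Y x] by (auto simp: continuous_map_IsoT)

lemma continuous_map_J: "continuous_map Y euclidean f \<Longrightarrow> continuous_map Y euclidean (\<lambda>t. J (f t))"
  unfolding continuous_map_euclidean_tendsto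
  by (auto intro: bounded_linear.tendsto[OF bounded_linear_J])

lemma topological_group_Isom: "topological_group IsoG IsoT"
  unfolding topological_group_def
proof (intro conjI group_Isom topspace_IsoT)
  interpret group IsoG by (rule group_Isom)
  have "continuous_map (prod_topology IsoT IsoT) euclideanreal
      (\<lambda>p. pr (fst p \<otimes>\<^bsub>IsoG\<^esub> snd p) (e i) \<bullet> e j)" for i j
  proof -
    \<comment> \<open>Carrying the left factor across as its inverse separates the variables: each
      side of the inner product is norm continuous in one of the two group elements.\<close>
    have "continuous_map (prod_topology IsoT IsoT) euclideanreal
        (\<lambda>p. J (pr (snd p) (e i)) \<bullet> gi (pr (fst p)) (J (e j)))"
      by (intro continuous_map_inner continuous_map_J continuous_map_pr
          continuous_map_fst continuous_map_snd)
    moreover have "pr (c \<otimes>\<^bsub>IsoG\<^esub> d) (e i) \<bullet> e j = J (pr d (e i)) \<bullet> gi (pr c) (J (e j))"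
      if "c \<in> carrier IsoG" "d \<in> carrier IsoG" for c d
      using that
      by (simp add: pr_mult inner_eq_bil[of "pr c (pr d (e i))"] bil_gi[OF pr_O1inf[OF that(1)]])
        (simp add: bil_eq_inner)
    ultimately show ?thesis
      by (elim continuous_map_eq) auto
  qed
  then show "continuous_map (prod_topology IsoT IsoT) IsoT (\<lambda>(g, h). g \<otimes>\<^bsub>IsoG\<^esub> h)"
    by (auto simp: continuous_map_IsoT case_prod_unfold)
  have "continuous_map IsoT euclideanreal (\<lambda>c. pr (inv\<^bsub>IsoG\<^esub> c) (e i) \<bullet> e j)" for i j
  proof -
    have "continuous_map IsoT euclideanreal (\<lambda>c. gi (pr c) (e i) \<bullet> e j)"
      using continuous_map_pr(2)[OF continuous_map_id] by (intro continuous_map_inner) auto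
    then show ?thesis
      by (rule continuous_map_eq) (simp add: pr_inv)
  qed
  then show "continuous_map IsoT IsoT (\<lambda>g. inv\<^bsub>IsoG\<^esub> g)"
    by (auto simp: continuous_map_IsoT)
qed

section \<open>The isometry group is Polish\<close>

text \<open>A common criterion for the two embeddings of the group: a continuous map is an embedding
  as soon as the coefficients can be read off continuously from its values.\<close>

lemma IsoT_homeomorphic_image:
  assumes E: "continuous_map IsoT P E"
    and \<psi>: "\<And>i j. continuous_map P euclideanreal (\<psi> i j)"
    and coeff: "\<And>i j c. c \<in> carrier IsoG \<Longrightarrow> \<psi> i j (E c) = pr c (e i) \<bullet> e j"
  shows "IsoT homeomorphic_space subtopology P (E ` carrier IsoG)"
proof -
  have inj: "inj_on E (carrier IsoG)"
  proof (rule inj_onI)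
    fix c d assume cd: "c \<in> carrier IsoG" "d \<in> carrier IsoG" "E c = E d"
    \<comment> \<open>A constant sequence: equal coefficients make it converge to
      \<open>pr d x\<close>, so the coefficients determine the isometry.\<close>
    have "((\<lambda>n. pr c x) \<longlongrightarrow> pr d x) sequentially" for x
    proof (rule strong_limit[where G = "\<lambda>_. pr c"])
      show "((\<lambda>n. pr c (e i) \<bullet> e j) \<longlongrightarrow> pr d (e i) \<bullet> e j) sequentially" for i j
        using coeff[of c i j] coeff[of d i j] cd by simp
    qed (use cd pr_O_plus in auto)
    then have "pr c = pr d" by (simp add: LIMSEQ_const_iff fun_eq_iff)
    then show "c = d" using coset_pr cd by metis
  qed
  let ?R = "inv_into (carrier IsoG) E"
  have "continuous_map (subtopology P (E ` carrier IsoG)) euclideanreal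
      (\<lambda>p. pr (?R p) (e i) \<bullet> e j)" for i j
  proof -
    have "continuous_map (subtopology P (E ` carrier IsoG)) euclideanreal (\<psi> i j)"
      using \<psi> by (rule continuous_map_from_subtopology)
    then show ?thesis
      by (rule continuous_map_eq) (auto simp: inv_into_f_f[OF inj] coeff)
  qed
  then have "continuous_map (subtopology P (E ` carrier IsoG)) IsoT ?R"
    by (auto simp: continuous_map_IsoT inv_into_f_f[OF inj])
  then show ?thesis
    using homeomorphic_space_image[of E IsoT P] inj E by simp
qed

text \<open>The coefficients embed the group in a countable power of the reals. Second countability,
  unlike separability, passes to an arbitrary subspace.\<close>

lemma separable_IsoT: "separable_space IsoT"
proof -
  let ?E = "\<lambda>c. \<lambda>(i, j). pr c (e i) \<bullet> e j :: real"
  let ?P = "product_topology (\<lambda>_ :: nat \<times> nat. euclideanreal) UNIV"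
  have "IsoT homeomorphic_space subtopology ?P (?E ` carrier IsoG)"
  proof (rule IsoT_homeomorphic_image[where \<psi> = "\<lambda>i j p. p (i, j)"])
    show "continuous_map IsoT ?P ?E"
      by (auto simp: continuous_map_componentwise_UNIV continuous_map_IsoT_coeff)
  qed (auto intro: continuous_map_product_projection)
  moreover have "second_countable ?P"
    unfolding euclidean_product_topology by (rule second_countable_euclidean)
  ultimately show ?thesis
    using homeomorphic_space_second_countability second_countable_subtopology
      second_countable_imp_separable_space by blast
qed

text \<open>Convergence at \<open>e 0\<close> bounds the coefficients (g_k e_0)_0, hence the
  operator norms. Convergence on the basis then spreads to all vectors by density, with completeness
  of the space providing the limits.\<close>

lemma pointwise_limit:
  assumes g: "\<And>k. g k \<in> O_plus" and conv: "\<And>n. convergent (\<lambda>k. g k (e n))"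
  obtains C f where "C \<ge> 0" "\<And>k x. norm (g k x) \<le> C * norm x" "linear f"
    "\<And>x. norm (f x) \<le> C * norm x" "\<And>x. (\<lambda>k. g k x) \<longlonglongrightarrow> f x"
proof -
  obtain l where "(\<lambda>k. g k (e 0)) \<longlonglongrightarrow> l"
    using conv[of 0] by (auto simp: convergent_def)
  then have "(\<lambda>k. 2 * (g k (e 0) \<bullet> e 0)) \<longlonglongrightarrow> 2 * (l \<bullet> e 0)"
    by (intro tendsto_intros)
  then have "convergent (\<lambda>k. 2 * (g k (e 0) \<bullet> e 0))"
    by (rule convergentI)
  then obtain C where C: "C > 0" "\<And>k. norm (2 * (g k (e 0) \<bullet> e 0)) \<le> C"
    using convergent_imp_Bseq by (metis BseqE)
  have lin: "linear (g k)" for k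
    using g O_plus_O1inf O1inf_linear by blast
  have bd: "norm (g k x) \<le> C * norm x" for k x
  proof -
    have "norm (g k x) \<le> 2 * (g k (e 0) \<bullet> e 0) * norm x" by (rule norm_O_plus_le[OF g])
    also have "\<dots> \<le> C * norm x"
      using C(2)[of k] by (intro mult_right_mono) auto
    finally show ?thesis .
  qed
  have "Cauchy (\<lambda>k. g k x)" for x
  proof -
    \<comment> \<open>The Cauchy property is phrased as convergence of differences to 0 along the
      product filter, so that the density lemma applies with limit map 0.\<close>
    let ?F = "sequentially \<times>\<^sub>F sequentially"
    have lim: "((\<lambda>p. g (fst p) x - g (snd p) x) \<longlongrightarrow> 0) ?F"
    proof (rule tendsto_closure_span[where S = "range e" and B = "2 * C" and
          f = "\<lambda>p x. g (fst p) x - g (snd p) x" and ?f0.0 = "\<lambda>x. 0"])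
      show "\<forall>\<^sub>F p in ?F. linear (\<lambda>x. g (fst p) x - g (snd p) x) \<and>
          (\<forall>x. norm (g (fst p) x - g (snd p) x) \<le> 2 * C * norm x)"
      proof (intro always_eventually allI conjI)
        fix p
        show "linear (\<lambda>x. g (fst p) x - g (snd p) x)"
          by (intro linear_compose_sub lin)
        show "norm (g (fst p) x - g (snd p) x) \<le> 2 * C * norm x" for x
          using norm_triangle_ineq4[of "g (fst p) x" "g (snd p) x"] bd[of "fst p" x] bd[of "snd p" x]
          by simp
      qed
      show "((\<lambda>p. g (fst p) s - g (snd p) s) \<longlongrightarrow> 0) ?F" if s: "s \<in> range e" for s
      proof -
        obtain l where l: "(\<lambda>k. g k s) \<longlonglongrightarrow> l"
          using s conv by (auto simp: convergent_def)
        have "((\<lambda>p. g (fst p) s - g (snd p) s) \<longlongrightarrow> l - l) ?F"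
          by (intro tendsto_diff filterlim_compose[OF l]) (simp_all add: filterlim_def
              filtermap_fst_prod_filter filtermap_snd_prod_filter)
        then show ?thesis by simp
      qed
    qed (use C in \<open>auto simp: linear_iff e_total\<close>)
    show ?thesis
    proof (rule CauchyI)
      fix \<epsilon> :: real assume "\<epsilon> > 0"
      then have "\<forall>\<^sub>F p in ?F. norm (g (fst p) x - g (snd p) x) < \<epsilon>"
        using tendstoD[OF lim, of \<epsilon>] by simp
      then show "\<exists>M. \<forall>m\<ge>M. \<forall>n\<ge>M. norm (g m x - g n x) < \<epsilon>"
        unfolding eventually_prod_sequentially by (auto simp: norm_minus_commute)
    qed
  qed
  then have lim: "(\<lambda>k. g k x) \<longlonglongrightarrow> lim (\<lambda>k. g k x)" for x
    by (simp add: Cauchy_convergent_iff convergent_LIMSEQ_iff)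
  show thesis
  proof (rule that[of C "\<lambda>x. lim (\<lambda>k. g k x)"])
    show "linear (\<lambda>x. lim (\<lambda>k. g k x))"
    proof (rule linearI)
      show "lim (\<lambda>k. g k (x + y)) = lim (\<lambda>k. g k x) + lim (\<lambda>k. g k y)" for x y
        using tendsto_add[OF lim lim] lin by (intro limI) (simp add: linear_add)
      show "lim (\<lambda>k. g k (a *\<^sub>R x)) = a *\<^sub>R lim (\<lambda>k. g k x)" for a x
        using tendsto_scaleR[OF tendsto_const lim] lin by (intro limI) (simp add: linear_scale)
    qed
    show "norm (lim (\<lambda>k. g k x)) \<le> C * norm x" for x
      using bd by (intro LIMSEQ_le_const2[OF tendsto_norm[OF lim]]) auto
  qed (use C bd lim in auto)
qed

text \<open>Strong limits compose under a uniform bound: g_k (h_k x - h0 x) is at most C |h_k x - h0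
  x|.\<close>

lemma limit_comp_id:
  assumes "\<And>k x. norm (g k x) \<le> C * norm x" "\<And>k. linear (g k)" "\<And>k x. g k (h k x) = x"
    "\<And>x. (\<lambda>k. g k x) \<longlonglongrightarrow> g0 x" "\<And>x. (\<lambda>k. h k x) \<longlonglongrightarrow> h0 x"
  shows "g0 (h0 x) = (x :: 'a)"
proof -
  have "(\<lambda>k. C * norm (h k x - h0 x)) \<longlonglongrightarrow> C * norm (h0 x - h0 x)"
    by (intro tendsto_intros assms)
  then have lim: "(\<lambda>k. C * norm (h k x - h0 x)) \<longlonglongrightarrow> 0"
    by (simp only: diff_self norm_zero mult_zero_right)
  have "(\<lambda>k. g k (h k x - h0 x)) \<longlonglongrightarrow> 0"
    by (rule Lim_null_comparison[OF _ lim]) (intro always_eventually allI assms(1))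
  then have "(\<lambda>k. x - g k (h0 x)) \<longlonglongrightarrow> 0"
    using assms(2,3) by (simp add: linear_diff)
  from tendsto_diff[OF tendsto_const[of x] this]
  have "(\<lambda>k. g k (h0 x)) \<longlonglongrightarrow> x" by simp
  then show ?thesis
    using assms(4) LIMSEQ_unique by blast
qed

text \<open>A strong limit of bijective isometries of the form can fail to be surjective. Recording
  the inverses as well forces them to converge too, and their limit is a two-sided inverse of the
  limit map; this makes the image closed.\<close>

lemma completely_metrizable_IsoT: "completely_metrizable_space IsoT"
proof -
  let ?E = "\<lambda>c. \<lambda>n. (pr c (e n), gi (pr c) (e n))"
  let ?P = "product_topology (\<lambda>_ :: nat. euclidean :: ('a \<times> 'a) topology) UNIV"
  have "IsoT homeomorphic_space subtopology ?P (?E ` carrier IsoG)"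
  proof (rule IsoT_homeomorphic_image[where \<psi> = "\<lambda>i j p. fst (p i) \<bullet> e j"])
    have "continuous_map IsoT euclidean (\<lambda>c. (pr c (e n), gi (pr c) (e n)))" for n
      using continuous_map_pr[OF continuous_map_id]
      unfolding continuous_map_euclidean_tendsto by (auto intro: tendsto_Pair)
    then show "continuous_map IsoT ?P ?E"
      by (simp add: continuous_map_componentwise_UNIV)
    have "continuous_map ?P euclidean (\<lambda>p. fst (p i))" for i
    proof -
      have "continuous_map ?P euclidean (\<lambda>p. p i)"
        by (rule continuous_map_product_projection) simp
      then show ?thesis
        unfolding continuous_map_euclidean_tendsto by (auto intro: tendsto_fst)
    qed
    then show "continuous_map ?P euclideanreal (\<lambda>p. fst (p i) \<bullet> e j)" for i j
      by (intro continuous_map_inner) auto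
  qed simp
  moreover have "closed (?E ` carrier IsoG)"
    unfolding closed_sequential_limits
  proof (intro allI impI, elim conjE)
    fix s p assume "\<forall>k. s k \<in> ?E ` carrier IsoG" and lim: "s \<longlonglongrightarrow> p"
    then have "\<forall>k. \<exists>c. c \<in> carrier IsoG \<and> s k = ?E c" by (simp add: image_iff Bex_def)
    from choice[OF this] obtain c where c: "\<And>k. c k \<in> carrier IsoG" "\<And>k. s k = ?E (c k)"
      by blast
    define g where "g k = pr (c k)" for k
    have gO: "g k \<in> O_plus" and giO: "gi (g k) \<in> O_plus" and g1: "g k \<in> carrier (O1inf e)" for k
      using c(1) pr_O_plus O_plus_gi O_plus_O1inf by (auto simp: g_def)
    have "(\<lambda>k. s k n) \<longlonglongrightarrow> p n" for n
      using lim limitin_componentwise[of "\<lambda>_. euclidean" UNIV s p sequentially]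
      by (simp add: euclidean_product_topology)
    then have lims: "(\<lambda>k. g k (e n)) \<longlonglongrightarrow> fst (p n)" "(\<lambda>k. gi (g k) (e n)) \<longlonglongrightarrow> snd (p n)" for n
      using tendsto_fst[of "\<lambda>k. s k n" "p n"] tendsto_snd[of "\<lambda>k. s k n" "p n"]
      by (simp_all add: c(2) g_def)
    obtain C a where C: "C \<ge> 0" "\<And>k x. norm (g k x) \<le> C * norm x" and a: "linear a"
      "\<And>x. norm (a x) \<le> C * norm x" "\<And>x. (\<lambda>k. g k x) \<longlonglongrightarrow> a x"
      using pointwise_limit[of g] gO lims(1) unfolding convergent_def by metis
    obtain D b where D: "D \<ge> 0" "\<And>k x. norm (gi (g k) x) \<le> D * norm x" and b: "linear b"
      "\<And>x. norm (b x) \<le> D * norm x" "\<And>x. (\<lambda>k. gi (g k) x) \<longlonglongrightarrow> b x"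
      using pointwise_limit[of "\<lambda>k. gi (g k)"] giO lims(2) unfolding convergent_def by metis
    have ab: "a (b x) = x" for x
      by (rule limit_comp_id[where g = g and C = C and h = "\<lambda>k. gi (g k)"])
        (intro C(2) O1inf_linear[OF g1] O1inf_gi(1)[OF g1] a(3) b(3))+
    have ba: "b (a x) = x" for x
      by (rule limit_comp_id[where g = "\<lambda>k. gi (g k)" and C = D and h = g])
        (intro D(2) O1inf_linear[OF O1inf_gi_closed[OF g1]] O1inf_gi(2)[OF g1] a(3) b(3))+
    have "bij a" by (rule o_bij[of b]) (auto simp: fun_eq_iff ab ba)
    moreover have "bounded_linear a"
      using a by (intro bounded_linear_intro[of _ C]) (auto simp: linear_add linear_scale mult.commute)
    moreover have "Q e (a x) = Q e x" for x
    proof -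
      have "(\<lambda>k. Q e (g k x)) \<longlonglongrightarrow> Q e (a x)"
        unfolding Q_eq by (intro tendsto_intros a(3))
      then show ?thesis
        using g1 by (simp add: O1inf_iff LIMSEQ_const_iff)
    qed
    ultimately have aO: "a \<in> carrier (O1inf e)"
      by (simp add: O1inf_iff)
    \<comment> \<open>The strict inequality that defines \<open>O_plus\<close> becomes weak in the
      limit; the coordinate cannot vanish, because Q (a e_0) = 1.\<close>
    have "a (e 0) \<bullet> e 0 \<ge> 0"
      using gO by (intro LIMSEQ_le_const[OF tendsto_inner[OF a(3) tendsto_const]])
        (auto simp: O_plus_def less_imp_le)
    then have aP: "a \<in> O_plus"
      using aO forward_nonzero[of "a (e 0)"] by (cases rule: O_plus_cases[OF aO])
        (auto simp: O_plus_def)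
    have "gi a = b"
      using ab ba by (intro inv_unique_comp) (auto simp: fun_eq_iff)
    then have "p n = ?E (coset a) n" for n
      using LIMSEQ_unique[OF lims(1) a(3)] LIMSEQ_unique[OF lims(2) b(3)]
      by (simp add: pr_coset aP prod_eq_iff)
    then show "p \<in> ?E ` carrier IsoG"
      using coset_closed[OF aO] by blast
  qed
  then have "completely_metrizable_space (subtopology ?P (?E ` carrier IsoG))"
    unfolding euclidean_product_topology
    by (intro completely_metrizable_space_closedin completely_metrizable_space_euclidean)
      (simp add: closed_closedin[symmetric])
  ultimately show ?thesis
    by (simp only: homeomorphic_completely_metrizable_space)
qed

lemma polish_group_Isom: "polish_group IsoG IsoT"
  by (simp add: polish_group_def topological_group_Isom separable_IsoT completely_metrizable_IsoT)

section \<open>The weak topology\<close>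

abbreviation "HB \<equiv> hyp_bar e"
abbreviation "HT \<equiv> weak_hyp_bar e"

lemma topspace_HT [simp]: "topspace HT = HB"
  by (auto simp: weak_hyp_bar_def weak_topology_def topspace_pullback_topology pt_mem)

lemma norm_pt: "L \<in> HB \<Longrightarrow> norm (pt L) \<le> 1"
  using pt_mem[of L] by (simp add: disc_bar_def)

lemma pt_e0: "L \<in> HB \<Longrightarrow> pt L \<bullet> e 0 = 0"
  using pt_mem[of L] by (simp add: disc_bar_def)

lemma weak_limit:
  assumes f: "\<forall>\<^sub>F t in F. norm (f t) \<le> 1" and l: "norm l \<le> 1"
    and coeff: "\<And>i. ((\<lambda>t. f t \<bullet> e i) \<longlongrightarrow> l \<bullet> e i) F"
  shows "((\<lambda>t. f t \<bullet> y) \<longlongrightarrow> l \<bullet> y) F"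
proof (rule tendsto_closure_span[where S = "range e" and B = 1 and
        f = "\<lambda>t y. f t \<bullet> y" and ?f0.0 = "\<lambda>y. l \<bullet> y"])
  have bd: "norm (a \<bullet> y) \<le> 1 * norm y" if "norm a \<le> 1" for a y :: 'a
    using Cauchy_Schwarz_ineq2[of a y] mult_right_mono[OF that norm_ge_zero[of y]] by simp
  show "\<forall>\<^sub>F t in F. linear (\<lambda>y. f t \<bullet> y) \<and> (\<forall>y. norm (f t \<bullet> y) \<le> 1 * norm y)"
    using f by eventually_elim (intro conjI allI bd, auto intro!: linearI simp: inner_add_right)
  show "linear (\<lambda>y. l \<bullet> y)"
    by (rule linearI) (simp_all add: inner_add_right)
  show "norm (l \<bullet> y) \<le> 1 * norm y" for y
    by (rule bd[OF l])
qed (use coeff e_total in auto)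

text \<open>By Riesz representation every functional in \<open>weak_topology\<close> is an inner
  product, and on the unit ball convergence of the coordinates extends to all inner
  products.\<close>

lemma limitin_HT:
  assumes f: "\<forall>\<^sub>F t in F. f t \<in> HB" and L: "L \<in> HB"
    and coeff: "\<And>i. ((\<lambda>t. pt (f t) \<bullet> e i) \<longlongrightarrow> pt L \<bullet> e i) F"
  shows "limitin HT f L F"
  unfolding weak_hyp_bar_def
proof (rule limitin_pullback_topology[OF L f])
  have "limitin weak_topology (\<lambda>t. pt (f t)) (pt L) F"
    unfolding weak_topology_def
  proof (rule limitin_pullback_topology)
    have "((\<lambda>t. blinfun_apply \<phi> (pt (f t))) \<longlongrightarrow> blinfun_apply \<phi> (pt L)) F" for \<phi> :: "'a \<Rightarrow>\<^sub>L real"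
    proof -
      obtain y where y: "\<And>x. blinfun_apply \<phi> x = x \<bullet> y"
        using Riesz_representation[of \<phi>] by blast
      have "\<forall>\<^sub>F t in F. norm (pt (f t)) \<le> 1"
        using f by eventually_elim (rule norm_pt)
      then show ?thesis
        unfolding y using norm_pt[OF L] coeff by (rule weak_limit)
    qed
    then show "limitin (product_topology (\<lambda>_. euclideanreal) UNIV)
        (\<lambda>t \<phi>. blinfun_apply \<phi> (pt (f t))) (\<lambda>\<phi>. blinfun_apply \<phi> (pt L)) F"
      by (simp add: limitin_componentwise)
  qed auto
  then show "limitin (subtopology weak_topology (disc_bar e)) (\<lambda>t. pt (f t)) (pt L) F"
    using f pt_mem[OF L] by (auto simp: limitin_subtopology pt_mem elim!: eventually_mono)
qed

lemma continuous_map_HT_inner: "continuous_map HT euclideanreal (\<lambda>L. pt L \<bullet> y)"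
proof -
  have "continuous_map (weak_topology :: 'a topology) euclideanreal
      ((\<lambda>f. f (blinfun_inner_left y)) \<circ> (\<lambda>x f. blinfun_apply f x))"
    unfolding weak_topology_def
    by (intro continuous_map_pullback continuous_map_product_projection) simp
  then have "continuous_map (weak_topology :: 'a topology) euclideanreal (\<lambda>x. x \<bullet> y)"
    by (simp add: comp_def)
  then have "continuous_map (subtopology weak_topology (disc_bar e)) euclideanreal (\<lambda>x. x \<bullet> y)"
    by (rule continuous_map_from_subtopology)
  then have "continuous_map HT euclideanreal ((\<lambda>x. x \<bullet> y) \<circ> pt)"
    unfolding weak_hyp_bar_def by (rule continuous_map_pullback)
  then show ?thesis by (simp add: comp_def)
qed

lemma continuous_map_HT:
  assumes "f \<in> topspace Y \<rightarrow> HB" "\<And>i. continuous_map Y euclideanreal (\<lambda>t. pt (f t) \<bullet> e i)"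
  shows "continuous_map Y HT f"
  unfolding continuous_map_atin
proof
  fix t assume t: "t \<in> topspace Y"
  show "limitin HT f (f t) (atin Y t)"
  proof (rule limitin_HT)
    show "\<forall>\<^sub>F u in atin Y t. f u \<in> HB"
      using assms(1) t by (auto simp: eventually_atin)
    show "((\<lambda>u. pt (f u) \<bullet> e i) \<longlongrightarrow> pt (f t) \<bullet> e i) (atin Y t)" for i
      using assms(2)[of i] t by (simp add: continuous_map_euclidean_tendsto)
  qed (use assms(1) t in auto)
qed

definition coords :: "'a set \<Rightarrow> nat \<Rightarrow> real" where
  "coords L i = pt L \<bullet> e i"

lemma coords_inj: "inj_on coords HB"
proof (rule inj_onI)
  fix L M assume LM: "L \<in> HB" "M \<in> HB" "coords L = coords M"
  then have "pt L = pt M"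
    by (intro eq_if_inner_e) (simp add: coords_def fun_eq_iff)
  then show "L = M" using LM pt_inj by blast
qed

text \<open>Riesz-Fischer identifies the image with a set cut out by closed conditions on finitely
  many coordinates each. Being also contained in a product of intervals, it is compact by
  Tychonoff.\<close>

lemma coords_image: "coords ` HB = {a. a 0 = 0 \<and> (\<forall>n. (\<Sum>i<n. (a i)\<^sup>2) \<le> 1)}"
proof (intro equalityI subsetI)
  fix a assume "a \<in> coords ` HB"
  then obtain L where L: "L \<in> HB" "a = coords L" by auto
  have "(\<Sum>i<n. (a i)\<^sup>2) \<le> 1" for n
    using Bessel[of "{..<n}" "pt L"] norm_pt[OF L(1)] power_le_one[of "norm (pt L)" 2]
    by (simp add: L coords_def)
  then show "a \<in> {a. a 0 = 0 \<and> (\<forall>n. (\<Sum>i<n. (a i)\<^sup>2) \<le> 1)}"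
    by (simp add: L coords_def pt_e0)
next
  fix a :: "nat \<Rightarrow> real" assume a: "a \<in> {a. a 0 = 0 \<and> (\<forall>n. (\<Sum>i<n. (a i)\<^sup>2) \<le> 1)}"
  then have "\<And>n. (\<Sum>i<n. (a i)\<^sup>2) \<le> 1" by blast
  then obtain x where x: "\<And>i. x \<bullet> e i = a i" "(norm x)\<^sup>2 \<le> 1"
    using Riesz_Fischer by metis
  then have "x \<in> disc_bar e"
    using a x(1)[of 0] by (simp add: disc_bar_def power2_le_imp_le[of "norm x" 1])
  then show "a \<in> coords ` HB"
    by (intro image_eqI[of _ _ "disc_line e x"])
      (auto simp: coords_def pt_disc_line disc_line_mem x fun_eq_iff)
qed

lemma HT_homeomorphic: "HT homeomorphic_space subtopology euclidean (coords ` HB)"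
proof -
  let ?P = "product_topology (\<lambda>_ :: nat. euclideanreal) UNIV"
  have "HT homeomorphic_space subtopology ?P (coords ` topspace HT)"
  proof (rule homeomorphic_space_image)
    show "continuous_map HT ?P coords"
      by (simp add: continuous_map_componentwise_UNIV coords_def continuous_map_HT_inner)
    show "continuous_map (subtopology ?P (coords ` topspace HT)) HT (inv_into (topspace HT) coords)"
    proof (rule continuous_map_HT)
      show "inv_into (topspace HT) coords \<in> topspace (subtopology ?P (coords ` topspace HT)) \<rightarrow> HB"
        by (auto simp: inv_into_f_f[OF coords_inj])
      fix i
      have "continuous_map (subtopology ?P (coords ` topspace HT)) euclideanreal (\<lambda>a. a i)"
        by (intro continuous_map_from_subtopology continuous_map_product_projection) simp
      then show "continuous_map (subtopology ?P (coords ` topspace HT)) euclideanreal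
          (\<lambda>a. pt (inv_into (topspace HT) coords a) \<bullet> e i)"
        by (rule continuous_map_eq) (auto simp: inv_into_f_f[OF coords_inj] coords_def)
    qed
  qed (simp add: coords_inj)
  then show ?thesis
    by (simp add: euclidean_product_topology)
qed

lemma compact_coords: "compact (coords ` HB)"
proof -
  let ?P = "product_topology (\<lambda>_ :: nat. euclideanreal) UNIV"
  have "compactin ?P (PiE UNIV (\<lambda>_. {-1..1}))"
    by (simp add: compactin_PiE)
  then have "compact (PiE (UNIV :: nat set) (\<lambda>_. {-1..1 :: real}))"
    by (simp add: euclidean_product_topology)
  moreover have "closed {a :: nat \<Rightarrow> real. a 0 = 0 \<and> (\<forall>n. (\<Sum>i<n. (a i)\<^sup>2) \<le> 1)}"
    by (intro closed_Collect_conj closed_Collect_all closed_Collect_eq closed_Collect_le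
        continuous_intros continuous_on_product_coordinates)
  moreover have "coords ` HB \<subseteq> PiE UNIV (\<lambda>_. {-1..1})"
  proof -
    have "\<bar>pt L \<bullet> e i\<bar> \<le> 1" if "L \<in> HB" for L i
      using Cauchy_Schwarz_ineq2[of "pt L" "e i"] norm_pt[OF that] by simp
    then show ?thesis by (auto simp: coords_def abs_le_iff)
  qed
  ultimately show ?thesis
    unfolding coords_image[symmetric] by (metis compact_Int_closed inf.absorb_iff2)
qed

lemma metrizable_HT: "metrizable_space HT"
  using homeomorphic_metrizable_space[OF HT_homeomorphic] metrizable_space_euclidean
    metrizable_space_subtopology by blast

lemma compact_HT: "compact_space HT"
  using homeomorphic_compact_space[OF HT_homeomorphic] compact_coords
  by (simp add: compact_space_subtopology)

section \<open>The flow\<close>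

lemma HB_vector:
  assumes "L \<in> HB"
  shows "L = span {e 0 + pt L}" "Q e (e 0 + pt L) \<ge> 0" "(e 0 + pt L) \<bullet> e 0 > 0"
    "Q e (e 0 + pt L) = 1 - (norm (pt L))\<^sup>2"
  using disc_line_pt[OF assms] disc_vector[OF pt_mem[OF assms]] by (auto simp: disc_line_def)

lemma pr_forward:
  assumes "c \<in> carrier IsoG" "Q e v \<ge> 0" "v \<bullet> e 0 > 0"
  shows "Q e (pr c v) \<ge> 0" "pr c v \<bullet> e 0 > 0" "Q e (pr c v) = Q e v"
  using O_plus_forward[OF pr_O_plus[OF assms(1)] assms(2,3)] pr_O1inf[OF assms(1)] assms(2)
  by (auto simp: O1inf_iff)

lemma line_act_closed: "c \<in> carrier IsoG \<Longrightarrow> L \<in> HB \<Longrightarrow> line_act e c L \<in> HB"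
  using HB_vector[of L] line_act_span pr_forward hyp_barI by metis

lemma line_act_mult:
  assumes "c \<in> carrier IsoG" "d \<in> carrier IsoG" "L \<in> HB"
  shows "line_act e (c \<otimes>\<^bsub>IsoG\<^esub> d) L = line_act e c (line_act e d L)"
proof -
  interpret group IsoG by (rule group_Isom)
  obtain v where v: "Q e v \<ge> 0" "v \<bullet> e 0 > 0" "L = span {v}"
    using assms(3) hyp_bar_iff by blast
  have "span {pr d v} \<in> HB"
    using assms(2) v by (intro hyp_barI pr_forward)
  then show ?thesis
    using assms v by (simp add: line_act_span hyp_barI pr_mult)
qed

lemma line_act_one: "L \<in> HB \<Longrightarrow> line_act e \<one>\<^bsub>IsoG\<^esub> L = L"
  using line_act_span[of "\<one>\<^bsub>IsoG\<^esub>" "e 0 + pt L"] HB_vector[of L] group_Isom pr_one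
  by (metis group.is_monoid id_apply monoid.one_closed)

lemma group_action_Isom: "group_action IsoG HB (line_act e)"
proof -
  interpret group IsoG by (rule group_Isom)
  have Bij: "line_act e c \<in> Bij HB" if c: "c \<in> carrier IsoG" for c
  proof -
    have "line_act e (inv\<^bsub>IsoG\<^esub> c) (line_act e c L) = L" "line_act e c (line_act e (inv\<^bsub>IsoG\<^esub> c) L) = L"
      if "L \<in> HB" for L
      using that c line_act_mult[of "inv\<^bsub>IsoG\<^esub> c" c L] line_act_mult[of c "inv\<^bsub>IsoG\<^esub> c" L]
      by (simp_all add: line_act_one)
    then have "bij_betw (line_act e c) HB HB"
      using c by (intro bij_betw_byWitness[where f' = "line_act e (inv\<^bsub>IsoG\<^esub> c)"])
        (auto simp: line_act_closed)
    then show ?thesis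
      by (simp add: Bij_def line_act_def)
  qed
  have "line_act e (c \<otimes>\<^bsub>IsoG\<^esub> d) = compose HB (line_act e c) (line_act e d)"
    if "c \<in> carrier IsoG" "d \<in> carrier IsoG" for c d
  proof
    fix L
    show "line_act e (c \<otimes>\<^bsub>IsoG\<^esub> d) L = compose HB (line_act e c) (line_act e d) L"
      using that by (cases "L \<in> HB") (simp_all add: compose_def line_act_mult, simp add: line_act_def)
  qed
  then show ?thesis
    unfolding group_action_def group_hom_def group_hom_axioms_def
    using Bij by (intro conjI group_BijGroup is_group) (simp add: hom_def BijGroup_def)
qed

lemma pt_line_act:
  assumes "c \<in> carrier IsoG" "Q e v \<ge> 0" "v \<bullet> e 0 > 0"
  shows "pt (line_act e c (span {v})) = (1 / (pr c v \<bullet> e 0)) *\<^sub>R pr c v - e 0"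
  using assms by (simp add: line_act_span hyp_barI pt_span pr_forward)

lemma flow_Isom: "flow IsoG IsoT HT (line_act e)"
  unfolding flow_def
proof (intro conjI topological_group_Isom compact_HT metrizable_imp_Hausdorff_space metrizable_HT)
  show "topspace HT \<noteq> {}"
    using hyp_barI[of "e 0"] by (auto simp: Q_e0 e_inner)
  show "group_action IsoG (topspace HT) (line_act e)"
    using group_action_Isom by simp
  let ?T = "prod_topology IsoT HT"
  define v where "v p = e 0 + pt (snd p)" for p :: "('a \<Rightarrow> 'a) set \<times> 'a set"
  have v_inner: "continuous_map ?T euclideanreal (\<lambda>p. v p \<bullet> y)" for y
  proof -
    have "continuous_map ?T euclideanreal (\<lambda>p. pt (snd p) \<bullet> y)"
      using continuous_map_compose[OF continuous_map_snd continuous_map_HT_inner]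
      by (simp add: comp_def)
    then show ?thesis
      by (simp add: v_def inner_add_left continuous_map_add)
  qed
  have coeff: "continuous_map ?T euclideanreal (\<lambda>p. pr (fst p) (v p) \<bullet> y)" for y
  proof -
    \<comment> \<open>The vector \<open>v p\<close> moves only weakly, so the isometry is carried to
      the fixed \<open>y\<close>, where it moves in norm. The bound 2 is |e_0| + |pt L| with both
      terms at most 1.\<close>
    have "continuous_map ?T euclideanreal (\<lambda>p. v p \<bullet> J (gi (pr (fst p)) (J y)))"
    proof (rule continuous_map_weak_inner[where B = 2])
      show "continuous_map ?T euclidean (\<lambda>p. J (gi (pr (fst p)) (J y)))"
        by (intro continuous_map_J continuous_map_pr continuous_map_fst)
      show "norm (v p) \<le> 2" if "p \<in> topspace ?T" for p
        using that norm_triangle_ineq[of "e 0" "pt (snd p)"] norm_pt[of "snd p"] by (auto simp: v_def)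
    qed (rule v_inner)
    moreover have "v (c, L) \<bullet> J (gi (pr c) (J y)) = pr c (v (c, L)) \<bullet> y"
      if "c \<in> carrier IsoG" for c L
      using bil_gi[OF pr_O1inf[OF that], of "v (c, L)" "J y"]
      by (simp add: bil_eq_inner J_inner)
    ultimately show ?thesis
      by (elim continuous_map_eq) auto
  qed
  show "continuous_map ?T HT (\<lambda>(g, x). line_act e g x)"
  proof (rule continuous_map_HT)
    show "(\<lambda>(g, x). line_act e g x) \<in> topspace ?T \<rightarrow> HB"
      by (auto simp: line_act_closed)
    fix i
    \<comment> \<open>The action in disc coordinates is projective; the denominator is positive
      because forward representatives keep forward vectors forward.\<close>
    have "continuous_map ?T euclideanreal
        (\<lambda>p. (pr (fst p) (v p) \<bullet> e i) / (pr (fst p) (v p) \<bullet> e 0) - e 0 \<bullet> e i)"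
      using HB_vector(2,3) by (intro continuous_map_diff continuous_map_real_divide coeff)
        (auto simp: v_def dest!: pr_forward(2))
    then show "continuous_map ?T euclideanreal (\<lambda>p. pt (case p of (g, x) \<Rightarrow> line_act e g x) \<bullet> e i)"
    proof (rule continuous_map_eq)
      fix p assume "p \<in> topspace ?T"
      then obtain c L where p: "p = (c, L)" "c \<in> carrier IsoG" "L \<in> HB" by auto
      have "pt (line_act e c L) = (1 / (pr c (v p) \<bullet> e 0)) *\<^sub>R pr c (v p) - e 0"
        using pt_line_act[OF p(2) HB_vector(2,3)[OF p(3)]] HB_vector(1)[OF p(3)] by (simp add: v_def p)
      then show "(pr (fst p) (v p) \<bullet> e i) / (pr (fst p) (v p) \<bullet> e 0) - e 0 \<bullet> e i =
          pt (case p of (g, x) \<Rightarrow> line_act e g x) \<bullet> e i"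
        by (simp add: p inner_diff_left)
    qed
  qed
qed

section \<open>The two orbits\<close>

text \<open>Since Q (e_0 + x) = 1 - |x|^2, these are the isotropic lines. The form with the norm
  suits the approximation and category arguments.\<close>

definition boundary_lines :: "'a set set" where
  "boundary_lines = {L \<in> HB. norm (pt L) = 1}"

definition inner_lines :: "'a set set" where
  "inner_lines = {L \<in> HB. norm (pt L) < 1}"

lemma HB_partition: "L \<in> HB \<Longrightarrow> L \<in> boundary_lines \<or> L \<in> inner_lines"
  using norm_pt[of L] by (auto simp: boundary_lines_def inner_lines_def)

text \<open>An isometry changes 1 - |pt L|^2 = Q (e_0 + pt L) only by the nonzero square that
  renormalises the \<open>e 0\<close>-coordinate to 1.\<close>

lemma norm_pt_line_act:
  assumes "c \<in> carrier IsoG" "L \<in> HB"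
  shows "norm (pt (line_act e c L)) = 1 \<longleftrightarrow> norm (pt L) = 1"
proof -
  define v z where "v = e 0 + pt L" and "z = pr c v"
  have v: "Q e v \<ge> 0" "v \<bullet> e 0 > 0" "L = span {v}" "Q e v = 1 - (norm (pt L))\<^sup>2"
    using HB_vector[OF assms(2)] by (simp_all add: v_def)
  have z: "z \<bullet> e 0 > 0" "Q e z = Q e v"
    using pr_forward[OF assms(1) v(1,2)] by (simp_all add: z_def)
  have "e 0 + pt (line_act e c L) = (1 / (z \<bullet> e 0)) *\<^sub>R z"
    using pt_line_act[OF assms(1) v(1,2)] by (simp add: v(3)[symmetric] z_def)
  then have "1 - (norm (pt (line_act e c L)))\<^sup>2 = (1 / (z \<bullet> e 0))\<^sup>2 * (1 - (norm (pt L))\<^sup>2)"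
    using HB_vector(4)[OF line_act_closed[OF assms]] by (simp add: Q_scale z(2) v(4))
  moreover have "(1 / (z \<bullet> e 0))\<^sup>2 \<noteq> 0" using z(1) by simp
  ultimately have "(norm (pt (line_act e c L)))\<^sup>2 = 1 \<longleftrightarrow> (norm (pt L))\<^sup>2 = 1"
    by (metis eq_iff_diff_eq_0 mult_eq_0_iff)
  then show ?thesis
    by (simp add: abs_square_eq_1)
qed

lemma orbit_transport:
  assumes "g \<in> O_plus" "g v = w" "Q e v \<ge> 0" "v \<bullet> e 0 > 0"
  shows "span {w} \<in> orbit IsoG (line_act e) (span {v})"
  using line_act_span[OF coset_closed[OF O_plus_O1inf[OF assms(1)]] hyp_barI[OF assms(3,4)]]
    coset_closed[OF O_plus_O1inf[OF assms(1)]] assms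
  by (auto simp: orbit_def pr_coset)

lemma inner_line_hyp:
  assumes "L \<in> inner_lines"
  obtains v where "v \<in> hyp e" "L = span {v}"
proof -
  define u where "u = e 0 + pt L"
  have L: "L \<in> HB" "norm (pt L) < 1" using assms by (auto simp: inner_lines_def)
  then have u: "Q e u > 0" "u \<bullet> e 0 > 0" "L = span {u}"
    using HB_vector[OF L(1)] power_strict_mono[of "norm (pt L)" 1 2] by (simp_all add: u_def)
  let ?v = "(1 / sqrt (Q e u)) *\<^sub>R u"
  have "?v \<in> hyp e"
    using u by (simp add: hyp_mem Q_scale power_divide)
  moreover have "span {?v} = span {u}"
    using u(1) span_image_scale[of "{u}" "\<lambda>_. 1 / sqrt (Q e u)"] by simp
  ultimately show ?thesis using that u(3) by metis
qed

lemma orbit_eq: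
  assumes "L \<in> HB"
  shows "orbit IsoG (line_act e) L = (if L \<in> boundary_lines then boundary_lines else inner_lines)"
proof (intro equalityI subsetI)
  fix M assume "M \<in> orbit IsoG (line_act e) L"
  then obtain c where c: "c \<in> carrier IsoG" "M = line_act e c L"
    by (auto simp: orbit_def)
  then show "M \<in> (if L \<in> boundary_lines then boundary_lines else inner_lines)"
    using norm_pt_line_act[OF c(1) assms] line_act_closed[OF c(1) assms] HB_partition[of M] assms
    by (auto simp: boundary_lines_def inner_lines_def)
next
  fix M assume M: "M \<in> (if L \<in> boundary_lines then boundary_lines else inner_lines)"
  interpret group_action IsoG HB "line_act e" by (rule group_action_Isom)
  show "M \<in> orbit IsoG (line_act e) L"
  proof (cases "L \<in> boundary_lines")
    case True
    then have b: "norm (pt L) = 1" "norm (pt M) = 1" "M \<in> HB"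
      using M by (auto simp: boundary_lines_def)
    note v = HB_vector[OF assms] and w = HB_vector[OF b(3)]
    show ?thesis
    proof (cases "pt L = pt M")
      case True
      then have "L = M" using pt_inj assms b(3) by blast
      then show ?thesis using b(3) id_eq_one by (metis orbit_refl)
    next
      case False
      \<comment> \<open>The difference has no component along \<open>e 0\<close>, so
        \<open>Q\<close> is minus its squared norm; distinct boundary lines are exchanged by one
        reflection.\<close>
      have "Q e (pt L - pt M) \<noteq> 0"
        using False by (simp add: Q_eq inner_diff_left pt_e0 assms b(3))
      then obtain g where "g \<in> O_plus" "g (e 0 + pt L) = e 0 + pt M"
        using exists_O_plus[of "e 0 + pt L" "e 0 + pt M"] v w b by auto
      then show ?thesis
        using orbit_transport[of g "e 0 + pt L" "e 0 + pt M"] v w by simp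
    qed
  next
    case False
    then have "L \<in> inner_lines" "M \<in> inner_lines"
      using M assms HB_partition by auto
    then obtain v w where v: "v \<in> hyp e" "L = span {v}" and w: "w \<in> hyp e" "M = span {w}"
      using inner_line_hyp by metis
    obtain g where g: "g \<in> O_plus" "g v = e 0" using hyp_to_e0[OF v(1)] .
    obtain h where h: "h \<in> O_plus" "h w = e 0" using hyp_to_e0[OF w(1)] .
    have "(gi h \<circ> g) v = w"
      using O1inf_gi(2)[OF O_plus_O1inf[OF h(1)], of w] g(2) h(2) by simp
    then show ?thesis
      using orbit_transport[OF O_plus_comp[OF O_plus_gi[OF h(1)] g(1)], of v w] v w
      by (simp add: hyp_mem)
  qed
qed

lemma disc_line_boundary: "x \<in> disc_bar e \<Longrightarrow> disc_line e x \<in> boundary_lines \<longleftrightarrow> norm x = 1"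
  and disc_line_inner: "x \<in> disc_bar e \<Longrightarrow> disc_line e x \<in> inner_lines \<longleftrightarrow> norm x < 1"
  by (simp_all add: boundary_lines_def inner_lines_def disc_line_mem pt_disc_line)

lemma orbits_eq: "orbits IsoG HB (line_act e) = {boundary_lines, inner_lines}"
  and orbits_distinct: "boundary_lines \<noteq> inner_lines"
proof -
  have b: "disc_line e (e 1) \<in> boundary_lines"
    by (subst disc_line_boundary) (simp_all add: disc_bar_def e_inner)
  have i: "disc_line e 0 \<in> inner_lines" "disc_line e 0 \<notin> boundary_lines"
    by (subst disc_line_inner disc_line_boundary; simp add: disc_bar_def)+
  have sub: "boundary_lines \<subseteq> HB" "inner_lines \<subseteq> HB"
    by (auto simp: boundary_lines_def inner_lines_def)
  show "orbits IsoG HB (line_act e) = {boundary_lines, inner_lines}"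
  proof (intro equalityI subsetI)
    fix S assume "S \<in> {boundary_lines, inner_lines}"
    moreover have "boundary_lines = orbit IsoG (line_act e) (disc_line e (e 1))" "disc_line e (e 1) \<in> HB"
      using b sub by (auto simp: orbit_eq)
    moreover have "inner_lines = orbit IsoG (line_act e) (disc_line e 0)" "disc_line e 0 \<in> HB"
      using i sub by (auto simp: orbit_eq)
    ultimately show "S \<in> orbits IsoG HB (line_act e)"
      unfolding orbits_def by blast
  next
    fix S assume "S \<in> orbits IsoG HB (line_act e)"
    then obtain L where "L \<in> HB" "S = orbit IsoG (line_act e) L"
      by (auto simp: orbits_def)
    then show "S \<in> {boundary_lines, inner_lines}"
      by (simp add: orbit_eq)
  qed
  show "boundary_lines \<noteq> inner_lines" using i by blast
qed

section \<open>Minimality and the comeager orbit\<close>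

text \<open>Infinite dimension at work: a point of the ball is pushed to the sphere along a far
  basis vector, which leaves the coordinates up to \<open>n\<close> unchanged, so the new points
  converge weakly to it.\<close>

lemma boundary_approximation:
  assumes x: "x \<in> disc_bar e"
  obtains y where "\<And>n. y n \<in> disc_bar e" "\<And>n. norm (y n) = 1"
    "\<And>i n. i \<le> n \<Longrightarrow> y n \<bullet> e i = x \<bullet> e i"
proof -
  \<comment> \<open>A root of |x + t e_(n+1)|^2 = 1; its discriminant is nonnegative because |x| is
    at most 1.\<close>
  define t where "t n = - (x \<bullet> e (Suc n)) + sqrt ((x \<bullet> e (Suc n))\<^sup>2 + 1 - (norm x)\<^sup>2)" for n
  define y where "y n = x + t n *\<^sub>R e (Suc n)" for n
  have nx: "(norm x)\<^sup>2 \<le> 1" using x by (simp add: disc_bar_def power_le_one)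
  have "(norm (y n))\<^sup>2 = (norm x)\<^sup>2 + 2 * t n * (x \<bullet> e (Suc n)) + (t n)\<^sup>2" for n
    unfolding y_def power2_norm_eq_inner
    by (simp add: inner_add_left inner_add_right e_inner inner_commute[of "e (Suc n)" x]
        power2_eq_square distrib_left)
  also have "\<dots> n = (norm x)\<^sup>2 - (x \<bullet> e (Suc n))\<^sup>2 + (t n + x \<bullet> e (Suc n))\<^sup>2" for n
    by (simp add: power2_eq_square algebra_simps)
  also have "\<dots> n = 1" for n
  proof -
    have "(x \<bullet> e (Suc n))\<^sup>2 + 1 - (norm x)\<^sup>2 \<ge> 0"
      using nx zero_le_power2[of "x \<bullet> e (Suc n)"] by linarith
    then show ?thesis by (simp add: t_def)
  qed
  finally have n1: "norm (y n) = 1" for n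
    by (metis norm_ge_zero power2_eq_1_iff abs_norm_cancel abs_1 abs_minus_cancel)
  show thesis
  proof
    show "y n \<in> disc_bar e" for n
      using x n1 by (simp add: disc_bar_def y_def inner_add_left e_inner)
    show "y n \<bullet> e i = x \<bullet> e i" if "i \<le> n" for i n
      using that by (simp add: y_def inner_add_left e_inner)
  qed (rule n1)
qed

lemma boundary_dense:
  assumes "L \<in> HB"
  shows "L \<in> HT closure_of boundary_lines"
proof -
  obtain y where y: "\<And>n. y n \<in> disc_bar e" "\<And>n. norm (y n) = 1"
    "\<And>i n. i \<le> n \<Longrightarrow> y n \<bullet> e i = pt L \<bullet> e i"
    using boundary_approximation[OF pt_mem[OF assms]] by metis
  have "limitin HT (\<lambda>n. disc_line e (y n)) L sequentially"
  proof (rule limitin_HT)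
    fix i
    have "\<forall>\<^sub>F n in sequentially. pt (disc_line e (y n)) \<bullet> e i = pt L \<bullet> e i"
      using eventually_ge_at_top[of i] by eventually_elim (simp add: pt_disc_line y)
    then show "(\<lambda>n. pt (disc_line e (y n)) \<bullet> e i) \<longlonglongrightarrow> pt L \<bullet> e i"
      by (rule tendsto_eventually)
  qed (use assms y in \<open>auto simp: disc_line_mem\<close>)
  then show ?thesis
    by (rule limitin_sequentially_closure_of) (simp add: disc_line_boundary y)
qed

lemma inner_dense:
  assumes "L \<in> HB"
  shows "L \<in> HT closure_of inner_lines"
proof -
  \<comment> \<open>Radial shrinking, with a factor strictly below 1 (and 0 for n = 0), so that
    boundary points are moved inside as well.\<close>
  define y where "y n = (1 - 1 / real (Suc n)) *\<^sub>R pt L" for n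
  have "norm (y n) < 1" for n
  proof -
    have "norm (y n) \<le> (1 - 1 / real (Suc n)) * 1"
      unfolding y_def using norm_pt[OF assms] by (simp add: mult_left_le)
    also have "\<dots> < 1" by simp
    finally show ?thesis .
  qed
  moreover have "y n \<in> disc_bar e" for n
    using calculation[of n] by (simp add: disc_bar_def) (simp add: y_def pt_e0 assms)
  ultimately have y: "norm (y n) < 1" "y n \<in> disc_bar e" for n by blast+
  have lim: "(\<lambda>n. 1 - 1 / real (Suc n)) \<longlonglongrightarrow> 1 - 0"
    by (intro tendsto_diff tendsto_const lim_1_over_n[THEN LIMSEQ_Suc])
  have "limitin HT (\<lambda>n. disc_line e (y n)) L sequentially"
  proof (rule limitin_HT)
    fix i
    have "(\<lambda>n. ((1 - 1 / real (Suc n)) *\<^sub>R pt L) \<bullet> e i) \<longlonglongrightarrow> ((1 - 0) *\<^sub>R pt L) \<bullet> e i"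
      by (intro tendsto_intros lim)
    then show "(\<lambda>n. pt (disc_line e (y n)) \<bullet> e i) \<longlonglongrightarrow> pt L \<bullet> e i"
      using y by (simp add: pt_disc_line y_def)
  qed (use assms y in \<open>auto simp: disc_line_mem\<close>)
  then show ?thesis
    by (rule limitin_sequentially_closure_of) (simp add: disc_line_inner y)
qed

lemma minimal_flow_Isom: "minimal_flow IsoG IsoT HT (line_act e)"
  unfolding minimal_flow_def
  using flow_Isom boundary_dense inner_dense closure_of_subset_topspace[of HT]
  by (auto simp: orbit_eq)

text \<open>The norm is weakly lower semicontinuous: its square is the supremum of the partial sums,
  each of which is weakly continuous.\<close>

lemma closedin_small_ball: "closedin HT {L \<in> HB. norm (pt L) \<le> r}" if "r \<ge> 0"
proof -
  have "norm (pt L) \<le> r \<longleftrightarrow> (\<forall>n. (\<Sum>i<n. (pt L \<bullet> e i)\<^sup>2) \<le> r\<^sup>2)" for L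
  proof
    assume "norm (pt L) \<le> r"
    then have "(norm (pt L))\<^sup>2 \<le> r\<^sup>2" by (simp add: power_mono)
    then show "\<forall>n. (\<Sum>i<n. (pt L \<bullet> e i)\<^sup>2) \<le> r\<^sup>2"
      using Bessel[of _ "pt L"] order_trans by blast
  next
    assume "\<forall>n. (\<Sum>i<n. (pt L \<bullet> e i)\<^sup>2) \<le> r\<^sup>2"
    then have "(norm (pt L))\<^sup>2 \<le> r\<^sup>2"
      using Parseval[of "pt L"] unfolding sums_def by (intro LIMSEQ_le_const2) auto
    then show "norm (pt L) \<le> r" using that by (rule power2_le_imp_le)
  qed
  then have "{L \<in> HB. norm (pt L) \<le> r} =
      (\<Inter>n. {L \<in> topspace HT. (\<Sum>i<n. (pt L \<bullet> e i)\<^sup>2) \<in> {..r\<^sup>2}})"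
    by auto
  moreover have "closedin HT {L \<in> topspace HT. (\<Sum>i<n. (pt L \<bullet> e i)\<^sup>2) \<in> {..r\<^sup>2}}" for n
    by (intro closedin_continuous_map_preimage[where Y = euclideanreal] continuous_map_sum
        continuous_map_real_pow continuous_map_HT_inner) auto
  ultimately show ?thesis
    by (simp add: closedin_INT)
qed

text \<open>The interior lines are a countable union of smaller balls. Each is weakly closed and
  misses the dense set of boundary lines, hence has empty interior.\<close>

lemma comeager_boundary: "comeager_in HT boundary_lines"
  unfolding comeager_in_def
proof (intro conjI exI[of _ "range (\<lambda>n. {L \<in> HB. norm (pt L) \<le> 1 - 1 / real (Suc n)})"] ballI)
  let ?A = "\<lambda>n. {L \<in> HB. norm (pt L) \<le> 1 - 1 / real (Suc n)}"
  show "boundary_lines \<subseteq> topspace HT" by (auto simp: boundary_lines_def)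
  show "countable (range ?A)" by simp
  show "nowhere_dense_in HT S" if S: "S \<in> range ?A" for S
  proof -
    obtain n where n: "S = ?A n" using S by blast
    have "closedin HT S"
      unfolding n by (rule closedin_small_ball) simp
    moreover have "HT interior_of S = {}"
    proof (rule ccontr)
      assume "HT interior_of S \<noteq> {}"
      then obtain L where L: "L \<in> HT interior_of S" by blast
      then have "L \<in> HB" using interior_of_subset_topspace[of HT S] by auto
      then obtain M where M: "M \<in> boundary_lines" "M \<in> HT interior_of S"
        using boundary_dense L unfolding in_closure_of by (metis openin_interior_of)
      then have "M \<in> S" using interior_of_subset[of HT S] by blast
      then show False using M(1) by (simp add: n boundary_lines_def)
    qed
    ultimately show ?thesis
      by (auto simp: nowhere_dense_in_def closure_of_closedin n)
  qed
  show "topspace HT - boundary_lines = \<Union> (range ?A)"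
  proof (intro equalityI subsetI)
    fix L assume "L \<in> topspace HT - boundary_lines"
    then have L: "L \<in> HB" "norm (pt L) < 1"
      using HB_partition[of L] by (auto simp: inner_lines_def)
    then obtain n where "inverse (real (Suc n)) < 1 - norm (pt L)"
      using reals_Archimedean[of "1 - norm (pt L)"] by auto
    then show "L \<in> \<Union> (range ?A)"
      using L by (auto simp: inverse_eq_divide intro!: exI[of _ n])
  next
    fix L assume "L \<in> \<Union> (range ?A)"
    then obtain n where "L \<in> HB" "norm (pt L) \<le> 1 - 1 / real (Suc n)" by blast
    then have "norm (pt L) \<noteq> 1" by (smt (verit) divide_pos_pos of_nat_0_less_iff zero_less_Suc)
    then show "L \<in> topspace HT - boundary_lines"
      using \<open>L \<in> HB\<close> by (simp add: boundary_lines_def)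
  qed
qed

section \<open>Strong proximality\<close>

text \<open>The quotient is insensitive to the sign of \<open>g\<close>, so any representative may
  be used. The reflections below need this: along a forward vector \<open>w\<close> with Q w > 0
  they send \<open>w\<close> to - w and so lie outside \<open>O_plus\<close>.\<close>

lemma pt_line_act_coset:
  assumes g: "g \<in> carrier (O1inf e)" and M: "M \<in> HB" and u: "u = e 0 + pt M"
  shows "g u \<bullet> e 0 \<noteq> 0" "pt (line_act e (coset g) M) = (1 / (g u \<bullet> e 0)) *\<^sub>R g u - e 0"
proof -
  have v: "M = span {u}" "Q e u \<ge> 0" "u \<bullet> e 0 > 0"
    using HB_vector[OF M] by (simp_all add: u)
  have *: "h u \<bullet> e 0 > 0 \<and> pt (line_act e (coset h) M) = (1 / (h u \<bullet> e 0)) *\<^sub>R h u - e 0"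
    if h: "h \<in> O_plus" for h
    using pt_line_act[OF coset_closed[OF O_plus_O1inf[OF h]] v(2,3)] O_plus_forward[OF h v(2,3)]
    by (simp add: v(1)[symmetric] pr_coset[OF h])
  show "g u \<bullet> e 0 \<noteq> 0" "pt (line_act e (coset g) M) = (1 / (g u \<bullet> e 0)) *\<^sub>R g u - e 0"
  proof (atomize (full), cases rule: O_plus_cases[OF g])
    case 1
    show "g u \<bullet> e 0 \<noteq> 0 \<and> pt (line_act e (coset g) M) = (1 / (g u \<bullet> e 0)) *\<^sub>R g u - e 0"
      using *[OF 1(1)] by simp
  next
    case 2
    show "g u \<bullet> e 0 \<noteq> 0 \<and> pt (line_act e (coset g) M) = (1 / (g u \<bullet> e 0)) *\<^sub>R g u - e 0"
      using *[OF 2(1)] by (simp add: coset_uminus)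
  qed
qed

text \<open>The reflections along non-isotropic vectors approaching an isotropic vector contract
  everything but its line to this line.\<close>

lemma contracting_reflections:
  assumes L: "L \<in> boundary_lines"
  obtains c where "\<And>n. c n \<in> carrier IsoG"
    "\<And>M. M \<in> HB \<Longrightarrow> M \<noteq> L \<Longrightarrow> limitin HT (\<lambda>n::nat. line_act e (c n) M) L sequentially"
proof -
  have LH: "L \<in> HB" and nL: "norm (pt L) = 1" using L by (auto simp: boundary_lines_def)
  define v where "v = e 0 + pt L"
  have v: "Q e v = 0" "v \<bullet> e 0 = 1"
    using HB_vector(4)[OF LH] nL pt_e0[OF LH] by (simp_all add: v_def inner_add_left e_inner)
  \<comment> \<open>Adding a multiple a > 0 of \<open>e 0\<close> leaves the isotropic cone: Q (v +
    a e_0) = 2 a + a^2, because Q v = 0 and v_0 = 1.\<close>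
  define w where "w n = v + (1 / real (Suc n)) *\<^sub>R e 0" for n
  have "Q e (v + a *\<^sub>R e 0) = 2 * a + a\<^sup>2" for a
  proof -
    have "bil e v v = 0" "bil e v (e 0) = 1" "bil e (e 0) v = 1" "bil e (e 0) (e 0) = 1"
      using v Q_e0 bil_e0[of v] bil_commute[of v "e 0"] by (simp_all add: Q_bil)
    then show ?thesis
      unfolding Q_bil bil_simps by (simp add: power2_eq_square distrib_left)
  qed
  then have Qw: "Q e (w n) = 2 * (1 / real (Suc n)) + (1 / real (Suc n))\<^sup>2" for n
    unfolding w_def .
  then have Qw0: "Q e (w n) \<noteq> 0" for n
    by (smt (verit) divide_pos_pos of_nat_0_less_iff zero_less_Suc zero_le_power2)
  have lim0: "(\<lambda>n. 1 / real (Suc n)) \<longlonglongrightarrow> 0"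
    by (rule lim_1_over_n[THEN LIMSEQ_Suc])
  have "(\<lambda>n. v + (1 / real (Suc n)) *\<^sub>R e 0) \<longlonglongrightarrow> v + 0 *\<^sub>R e 0"
    by (intro tendsto_intros lim0)
  then have limw: "w \<longlonglongrightarrow> v" by (simp add: w_def[abs_def])
  have "(\<lambda>n. Q e (w n)) \<longlonglongrightarrow> 2 * 0 + 0\<^sup>2"
    unfolding Qw by (intro tendsto_intros lim0)
  then have limQ: "(\<lambda>n. Q e (w n)) \<longlonglongrightarrow> 0" by simp
  show thesis
  proof
    show "coset (refl (w n)) \<in> carrier IsoG" for n
      by (intro coset_closed refl_O1inf Qw0)
    fix M assume M: "M \<in> HB" "M \<noteq> L"
    define u where "u = e 0 + pt M"
    \<comment> \<open>The value is 1 - pt M . pt L. It vanishes only in the equality case of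
      Cauchy-Schwarz, which would give M = L.\<close>
    have "bil e u v \<noteq> 0"
    proof
      assume "bil e u v = 0"
      then have "pt M \<bullet> pt L = 1"
        using pt_e0[OF LH] pt_e0[OF M(1)]
        by (simp add: bil_eq u_def v_def inner_add_left inner_add_right e_inner inner_commute[of "e 0" "pt L"])
      then have "(norm (pt M - pt L))\<^sup>2 = (norm (pt M))\<^sup>2 - 1"
        using nL unfolding power2_norm_eq_inner
        by (simp add: inner_diff_left inner_diff_right inner_commute[of "pt L" "pt M"] norm_eq_1)
      also have "\<dots> \<le> 0" using norm_pt[OF M(1)] by (simp add: power_le_one)
      finally have "pt M = pt L" by simp
      then show False using M pt_inj LH by blast
    qed
    \<comment> \<open>The reflected vector multiplied by Q (w n), which tends to 0: the line is the
      same, but now the vectors converge, to the nonzero multiple - 2 (bil u v) of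
      \<open>v\<close>.\<close>
    define z where "z n = Q e (w n) *\<^sub>R u - (2 * bil e u (w n)) *\<^sub>R w n" for n
    have z: "z n = Q e (w n) *\<^sub>R refl (w n) u" for n
      using Qw0[of n] by (simp add: z_def refl_def bil_commute scaleR_diff_right)
    have ptz: "pt (line_act e (coset (refl (w n))) M) = (1 / (z n \<bullet> e 0)) *\<^sub>R z n - e 0" for n
      using pt_line_act_coset[OF refl_O1inf[OF Qw0[of n]] M(1) u_def] Qw0[of n] by (simp add: z)
    have limz: "z \<longlonglongrightarrow> 0 *\<^sub>R u - (2 * bil e u v) *\<^sub>R v"
      unfolding z_def[abs_def] bil_eq_inner by (intro tendsto_intros limQ limw)
    have "(\<lambda>n. (1 / (z n \<bullet> e 0)) *\<^sub>R z n - e 0) \<longlonglongrightarrow>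
        (1 / ((0 *\<^sub>R u - (2 * bil e u v) *\<^sub>R v) \<bullet> e 0)) *\<^sub>R (0 *\<^sub>R u - (2 * bil e u v) *\<^sub>R v) - e 0"
      using \<open>bil e u v \<noteq> 0\<close> v(2) by (intro tendsto_intros limz) simp
    then have "(\<lambda>n. pt (line_act e (coset (refl (w n))) M)) \<longlonglongrightarrow> pt L"
      using \<open>bil e u v \<noteq> 0\<close> v(2) unfolding ptz by (simp add: v_def)
    then show "limitin HT (\<lambda>n. line_act e (coset (refl (w n))) M) L sequentially"
      by (intro limitin_HT tendsto_inner tendsto_const LH always_eventually allI line_act_closed
          coset_closed refl_O1inf Qw0 M)
  qed
qed

text \<open>Only countably many points can have nonzero measure, while a single arc of the boundary
  is uncountable.\<close>

lemma exists_null_boundary_line: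
  assumes "finite_measure \<mu>"
  obtains L where "L \<in> boundary_lines" "measure \<mu> {L} = 0"
proof -
  \<comment> \<open>A quarter of the unit circle in the plane of \<open>e 1\<close> and
    \<open>e 2\<close>; the first coordinate makes it injective.\<close>
  define x where "x s = s *\<^sub>R e 1 + sqrt (1 - s\<^sup>2) *\<^sub>R e 2" for s :: real
  have "(norm (x s))\<^sup>2 = 1" if "s \<in> {0..1}" for s
    using that power_le_one[of s 2] unfolding power2_norm_eq_inner x_def
    by (simp add: inner_add_left inner_add_right e_inner power2_eq_square[symmetric])
  then have n: "norm (x s) = 1" if "s \<in> {0..1}" for s
    using that by (simp add: power2_eq_1_iff) (metis norm_ge_zero not_one_le_zero neg_0_le_iff_le)
  then have d: "x s \<in> disc_bar e" if "s \<in> {0..1}" for s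
    using that by (simp add: disc_bar_def) (simp add: x_def inner_add_left e_inner)
  have "inj_on (\<lambda>s. disc_line e (x s)) {0..1}"
  proof (rule inj_onI)
    fix s t :: real assume "s \<in> {0..1}" "t \<in> {0..1}" "disc_line e (x s) = disc_line e (x t)"
    then have "x s = x t" using d disc_line_inj by (meson inj_onD)
    then have "x s \<bullet> e 1 = x t \<bullet> e 1" by simp
    then show "s = t" by (simp add: x_def inner_add_left e_inner)
  qed
  then have "uncountable ((\<lambda>s. disc_line e (x s)) ` {0..1})"
    using uncountable_closed_interval[of "0::real" 1] countable_image_inj_on by (metis zero_less_one)
  then have "\<not> (\<lambda>s. disc_line e (x s)) ` {0..1} \<subseteq> {L. measure \<mu> {L} \<noteq> 0}"
    using finite_measure.countable_support[OF assms] countable_subset by blast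
  then obtain s where "s \<in> {0..1}" "measure \<mu> {disc_line e (x s)} = 0"
    by blast
  then show thesis
    using that[of "disc_line e (x s)"] n d disc_line_boundary by metis
qed

lemma continuous_map_line_act:
  assumes "c \<in> carrier IsoG"
  shows "continuous_map HT HT (line_act e c)"
proof -
  have "continuous_map HT (prod_topology IsoT HT) (\<lambda>L. (c, L))"
    using assms by (intro continuous_map_pairedI) auto
  moreover have "continuous_map (prod_topology IsoT HT) HT (\<lambda>(g, x). line_act e g x)"
    using flow_Isom by (simp add: flow_def)
  ultimately have "continuous_map HT HT ((\<lambda>(g, x). line_act e g x) \<circ> (\<lambda>L. (c, L)))"
    by (rule continuous_map_compose)
  then show ?thesis by (simp add: comp_def)
qed

lemma strongly_proximal_Isom: "strongly_proximal_flow IsoG IsoT HT (line_act e)"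
  unfolding strongly_proximal_flow_def
proof (intro conjI flow_Isom ballI)
  fix \<mu> assume \<mu>: "\<mu> \<in> Prob HT"
  let ?B = "borel_measure_of HT"
  interpret prob_space \<mu> using \<mu> by (simp add: Prob_def)
  have sets_\<mu>: "sets \<mu> = sets ?B" and space_\<mu>: "space \<mu> = HB"
    using \<mu> by (simp_all add: Prob_def)
  obtain L where L: "L \<in> boundary_lines" "measure \<mu> {L} = 0"
    using exists_null_boundary_line[OF finite_measure_axioms] .
  have LH: "L \<in> HB" using L by (simp add: boundary_lines_def)
  obtain c where c: "\<And>n. c n \<in> carrier IsoG"
    "\<And>M. M \<in> HB \<Longrightarrow> M \<noteq> L \<Longrightarrow> limitin HT (\<lambda>n. line_act e (c n) M) L sequentially"
    using contracting_reflections[OF L(1)] by metis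
  \<comment> \<open>\<open>measure\<close> has the default value 0 on non-measurable sets, so
    \<open>measure \<mu> {L} = 0\<close> gives a null set only once the singleton is known to be
    Borel.\<close>
  have "closedin HT {L}"
    using LH metrizable_imp_Hausdorff_space[OF metrizable_HT]
    by (simp add: closedin_Hausdorff_singleton)
  then have "{L} \<in> sets \<mu>"
    by (simp add: sets_\<mu> closedin_borel_measure_of)
  then have "{L} \<in> null_sets \<mu>"
    using L(2) by (simp add: null_sets_def emeasure_eq_measure)
  then have AE_L: "AE M in \<mu>. M \<noteq> L"
    using AE_not_in by fastforce
  have meas: "line_act e (c n) \<in> measurable \<mu> \<mu>" for n
    using continuous_map_measurable[OF continuous_map_line_act[OF c(1)], of n]
    by (simp add: measurable_cong_sets[OF sets_\<mu> sets_\<mu>])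
  define C where "C = {f :: 'a set \<Rightarrow> real. continuous_map HT euclideanreal f}"
  have "limitin (weak_star_topology HT) (\<lambda>n. distr \<mu> \<mu> (line_act e (c n))) (return ?B L) sequentially"
    unfolding weak_star_topology_def Let_def C_def[symmetric]
  proof (rule limitin_pullback_topology)
    show "return ?B L \<in> Prob HT"
      using LH by (simp add: Prob_def prob_space_return)
    have "distr \<mu> \<mu> (line_act e (c n)) \<in> Prob HT" for n
      using prob_space_distr[OF meas] by (simp add: Prob_def sets_\<mu> space_\<mu>)
    then show "\<forall>\<^sub>F n in sequentially. distr \<mu> \<mu> (line_act e (c n)) \<in> Prob HT"
      by simp
    have "(\<lambda>n. integral\<^sup>L (distr \<mu> \<mu> (line_act e (c n))) f) \<longlonglongrightarrow> integral\<^sup>L (return ?B L) f"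
      if f: "f \<in> C" for f
    proof -
      have cf: "continuous_map HT euclideanreal f" using f by (simp add: C_def)
      have f\<mu>: "f \<in> borel_measurable \<mu>"
        using continuous_map_real_measurable[OF cf] by (simp add: measurable_cong_sets[OF sets_\<mu> refl])
      \<comment> \<open>Compactness bounds each test function; the constant \<open>B\<close> is the
        dominating function, integrable for a probability measure.\<close>
      have "compact (f ` HB)"
        using image_compactin[OF _ cf, of HB] compact_HT by (simp add: compact_space_def)
      then obtain B where B: "\<And>M. M \<in> HB \<Longrightarrow> norm (f M) \<le> B"
        using compact_imp_bounded by (metis bounded_iff imageI)
      have "(\<lambda>n. \<integral>M. f (line_act e (c n) M) \<partial>\<mu>) \<longlonglongrightarrow> (\<integral>M. f L \<partial>\<mu>)"
      proof (rule integral_dominated_convergence[where w = "\<lambda>_. B"])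
        show "AE M in \<mu>. (\<lambda>n. f (line_act e (c n) M)) \<longlonglongrightarrow> f L"
          using AE_L
        proof (rule AE_mp, intro AE_I2 impI)
          fix M assume "M \<in> space \<mu>" "M \<noteq> L"
          then have "limitin HT (\<lambda>n. line_act e (c n) M) L sequentially"
            using c(2) by (simp add: space_\<mu>)
          from continuous_map_limit[OF cf this]
          show "(\<lambda>n. f (line_act e (c n) M)) \<longlonglongrightarrow> f L"
            by (simp add: comp_def)
        qed
        show "AE M in \<mu>. norm (f (line_act e (c n) M)) \<le> B" for n
          using B line_act_closed[OF c(1)] by (intro AE_I2) (simp add: space_\<mu>)
      qed (use f\<mu> meas in auto)
      moreover have "(\<integral>M. f L \<partial>\<mu>) = integral\<^sup>L (return ?B L) f"
        using LH continuous_map_real_measurable[OF cf] by (simp add: integral_return prob_space)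
      ultimately show ?thesis
        by (simp add: integral_distr[OF meas f\<mu>])
    qed
    then show "limitin (product_topology (\<lambda>_. euclideanreal) C)
        (\<lambda>n. \<lambda>f\<in>C. integral\<^sup>L (distr \<mu> \<mu> (line_act e (c n))) f)
        (\<lambda>f\<in>C. integral\<^sup>L (return ?B L) f) sequentially"
      by (simp add: limitin_componentwise)
  qed
  then have "return ?B L \<in> weak_star_topology HT closure_of {distr \<mu> \<mu> (line_act e g) | g. g \<in> carrier IsoG}"
    by (rule limitin_sequentially_closure_of) (use c(1) in auto)
  then show "\<exists>x\<in>topspace HT. return ?B x
      \<in> weak_star_topology HT closure_of {distr \<mu> \<mu> (line_act e g) | g. g \<in> carrier IsoG}"
    using LH by auto
qed

end

theorem proposition6p2:
  fixes e :: "nat \<Rightarrow> 'a::{real_inner, complete_space}"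
  assumes "hilbert_basis e"
  shows "polish_group (Isom_hyp e) (Isom_topology e) \<and>
    metrizable_space (weak_hyp_bar e) \<and>
    strongly_proximal_flow (Isom_hyp e) (Isom_topology e) (weak_hyp_bar e) (line_act e) \<and>
    minimal_flow (Isom_hyp e) (Isom_topology e) (weak_hyp_bar e) (line_act e) \<and>
    topspace (weak_hyp_bar e) = hyp_bar e \<and>
    card (orbits (Isom_hyp e) (hyp_bar e) (line_act e)) = 2 \<and>
    (\<exists>\<Omega> \<in> orbits (Isom_hyp e) (hyp_bar e) (line_act e). comeager_in (weak_hyp_bar e) \<Omega>)"
proof -
  interpret hyperbolic_model e using assms by unfold_locales
  show ?thesis
    using polish_group_Isom metrizable_HT strongly_proximal_Isom minimal_flow_Isom
      orbits_distinct comeager_boundary by (simp add: orbits_eq)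
qed

end
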